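(* Let $0<\theta<1$, $1\le r<\infty$, $1<p<q<\infty$. Let $\frac1{p_\theta}=\frac{1-\theta}{p}+\frac{\theta}{q}$ and $\alpha_\theta=1-\theta-\frac1{p_\theta}$. Then $$\bigl(L^{(p}(\Omega),L^{q)}(\Omega)\bigr)_{\theta,r}=L^{p_\theta,r}(\log L)^{\alpha_\theta}$$ with equivalent norms.
   Context: $\Omega\subset\mathbb R^n$ is a bounded open set with $|\Omega|=1$; $f_*$ is the decreasing rearrangement of $|f|$ on $(0,1)$; $\log$ is the natural logarithm. Small Lebesgue space $L^{(p}(\Omega)$: measurable $f$ with $\|f\|_{(p}=\int_0^1(1-\log t)^{-1/p}(\int_0^t f_*^p)^{1/p}\frac{dt}{t}<\infty$. Grand Lebesgue space $L^{q)}(\Omega)$: measurable $f$ with $\|f\|_{q)}=\sup_{0<t<1}(1-\log t)^{-1/q}(\int_t^1 f_*^q)^{1/q}<\infty$. Lorentz–Zygmund space $L^{a,r}(\log L)^{\beta}$: measurable $f$ with $\bigl(\int_0^1[t^{1/a}(1-\log t)^{\beta}f_*(t)]^r\frac{dt}{t}\bigr)^{1/r}<\infty$. K-functional: $K(g,t;X_0,X_1)=\inf_{g=g_0+g_1}(\|g_0\|_{X_0}+t\|g_1\|_{X_1})$; $(X_0,X_1)_{\theta,r}$ is the set of $g\in X_0+X_1$ with $\bigl(\int_0^1[t^{-\theta}K(g,t)]^r\frac{dt}{t}\bigr)^{1/r}<\infty$. *)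

theory Defs
  imports "HOL-Analysis.Analysis"
begin

definition epowr :: "ennreal \<Rightarrow> real \<Rightarrow> ennreal" where
  "epowr x a = (if x = \<infinity> then \<infinity> else ennreal (enn2real x powr a))"

definition distrib_fun :: "'a::euclidean_space set \<Rightarrow> ('a \<Rightarrow> real) \<Rightarrow> real \<Rightarrow> ennreal" where
  "distrib_fun \<Omega> f s = emeasure lebesgue {x \<in> \<Omega>. s < \<bar>f x\<bar>}"

definition rearr :: "'a::euclidean_space set \<Rightarrow> ('a \<Rightarrow> real) \<Rightarrow> real \<Rightarrow> real" where
  "rearr \<Omega> f t = Inf {s::real. 0 \<le> s \<and> distrib_fun \<Omega> f s \<le> ennreal t}"

definition small_leb_norm :: "'a::euclidean_space set \<Rightarrow> real \<Rightarrow> ('a \<Rightarrow> real) \<Rightarrow> ennreal" where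
  "small_leb_norm \<Omega> p f =
     (\<integral>\<^sup>+ t. indicator {0<..<1::real} t * ennreal ((1 - ln t) powr (-1/p) / t)
        * epowr (\<integral>\<^sup>+ s. indicator {0<..<t} s * ennreal (rearr \<Omega> f s powr p) \<partial>lborel) (1/p)
      \<partial>lborel)"

definition grand_leb_norm :: "'a::euclidean_space set \<Rightarrow> real \<Rightarrow> ('a \<Rightarrow> real) \<Rightarrow> ennreal" where
  "grand_leb_norm \<Omega> q f =
     (SUP t\<in>{0<..<1::real}. ennreal ((1 - ln t) powr (-1/q))
        * epowr (\<integral>\<^sup>+ s. indicator {t<..<1} s * ennreal (rearr \<Omega> f s powr q) \<partial>lborel) (1/q))"

definition LZ_norm :: "'a::euclidean_space set \<Rightarrow> real \<Rightarrow> real \<Rightarrow> real \<Rightarrow> ('a \<Rightarrow> real) \<Rightarrow> ennreal" where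
  "LZ_norm \<Omega> a r \<beta> f =
     epowr (\<integral>\<^sup>+ t. indicator {0<..<1::real} t
        * ennreal ((t powr (1/a) * (1 - ln t) powr \<beta> * rearr \<Omega> f t) powr r / t) \<partial>lborel) (1/r)"

text \<open>K-functional of the couple (X0, X1) given by the (extended) norms N0, N1 on
  measurable functions on \<Omega>.\<close>
definition K_fun :: "'a::euclidean_space set \<Rightarrow> (('a \<Rightarrow> real) \<Rightarrow> ennreal) \<Rightarrow> (('a \<Rightarrow> real) \<Rightarrow> ennreal)
     \<Rightarrow> ('a \<Rightarrow> real) \<Rightarrow> real \<Rightarrow> ennreal" where
  "K_fun \<Omega> N0 N1 g t =
     (INF gg \<in> {(g0, g1). g0 \<in> borel_measurable lebesgue \<and> g1 \<in> borel_measurable lebesgue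
                 \<and> (\<forall>x\<in>\<Omega>. g x = g0 x + g1 x)}.
        N0 (fst gg) + ennreal t * N1 (snd gg))"

definition interp_norm :: "'a::euclidean_space set \<Rightarrow> (('a \<Rightarrow> real) \<Rightarrow> ennreal) \<Rightarrow> (('a \<Rightarrow> real) \<Rightarrow> ennreal)
     \<Rightarrow> real \<Rightarrow> real \<Rightarrow> ('a \<Rightarrow> real) \<Rightarrow> ennreal" where
  "interp_norm \<Omega> N0 N1 \<theta> r g =
     epowr (\<integral>\<^sup>+ t. indicator {0<..<1::real} t
        * epowr (ennreal (t powr (-\<theta>)) * K_fun \<Omega> N0 N1 g t) r * ennreal (1/t) \<partial>lborel) (1/r)"

end

theory Submission
  imports Defs
begin

text \<open>
  Write $h = f_*$, $L(t) = 1 - \log t$, and let $\varphi_0(s) = s^{1/p} L(s)^{1-1/p}$ and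
  $\varphi_1(s) = s^{1/q} L(s)^{-1/q}$ be, up to constants, the fundamental functions of the small
  and the grand Lebesgue space. Both spaces lie between the corresponding Lorentz and Marcinkiewicz
  spaces: the norm is at most $C \int_0^1 h \varphi_i \, du/u$ and at least
  $c \sup_u \varphi_i(u) h(u)$. These two bounds already suffice. Put
  $\rho = \varphi_0 / \varphi_1$. Splitting $g$ at the level $g_*(s)$ bounds $K(g, \rho(s))$ from
  above by a Hardy-type operator applied to $\varphi_0 g_*$, and
  $g_*(s) \le (g_0)_*(s/2) + (g_1)_*(s/2)$ gives $\varphi_0(s) g_*(s) \le C K(g, \rho(s))$. Since
  $\rho^{-\theta} \varphi_0$ is the weight of the Lorentz--Zygmund space, what remains is a Schur
  test and the change of variables $t = \rho(s)$. As $\rho$ need not be monotone near $1$, it is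
  replaced by the comparable function $s^a (1 - c^{-1} \log s)^{1-a}$ with $a = 1/p - 1/q$ and $c$
  large.
\<close>

section \<open>Powers of extended reals and decreasing rearrangements\<close>

text \<open>At each endpoint there is a genuine gap between the Lorentz and the Marcinkiewicz bound.
  It is harmless because \<rho> equals \<open>s powr a * L(s) powr (1 - a)\<close> with
  \<open>a = 1 / p - 1 / q > 0\<close> and so behaves like a positive power. In the upper bound for
  \<open>t powr (- \<theta>) * K g t\<close> at \<open>t = \<rho>(s)\<close>, the part
  \<open>u < s\<close> carries the factor \<open>(\<rho>(u) / \<rho>(s)) powr \<theta>\<close> and
  the part \<open>u > s\<close> the factor
  \<open>(\<rho>(s) / \<rho>(u)) powr (1 - \<theta>)\<close>. For 0 < \<theta> < 1 both decay like a
  power of \<open>min (u / s) (s / u)\<close>, and such a kernel is bounded on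
  \<open>L^r(du / u)\<close> for every \<open>r \<ge> 1\<close>. Two difficulties sit near 1: \<rho>
  may decrease there, and the lower bound for the small norm degenerates. The latter is avoided
  because that bound is applied only at half arguments \<open>s / 2 \<le> 1 / 2\<close>. All norms
  are extended reals and \<open>epowr\<close> keeps infinity, so the two inequalities also contain
  the equality of the spaces.\<close>

lemma epowr_ennreal: "0 \<le> x \<Longrightarrow> epowr (ennreal x) a = ennreal (x powr a)"
  by (simp add: epowr_def)

lemma epowr_mono:
  assumes "0 \<le> a" "x \<le> y"
  shows "epowr x a \<le> epowr y a"
  using assms by (auto simp: epowr_def top_unique intro!: ennreal_leI powr_mono2 enn2real_mono)
    (auto simp: less_top)

lemma epowr_cmult:
  assumes "0 < c"
  shows "epowr (ennreal c * x) a = ennreal (c powr a) * epowr x a"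
  using assms by (cases x) (auto simp: epowr_def ennreal_mult_top ennreal_mult[symmetric] powr_mult)

lemma epowr_0 [simp]: "epowr 0 a = 0"
  by (simp add: epowr_def)

lemma measurable_epowr [measurable]:
  assumes [measurable]: "f \<in> borel_measurable M"
  shows "(\<lambda>x. epowr (f x) a) \<in> borel_measurable M"
  unfolding epowr_def by measurable

text \<open>Convexity: \<open>x powr r\<close> lies above its tangent at \<open>m\<close>. Young's
  inequality with the exponents \<open>r\<close> and \<open>r / (r - 1)\<close> gives it, which is
  why \<open>r = 1\<close> is treated apart.\<close>

lemma powr_tangent:
  fixes x m r :: real
  assumes "1 \<le> r" "0 \<le> x" "0 < m"
  shows "r * m powr (r - 1) * x \<le> x powr r + (r - 1) * m powr r"
proof (cases "r = 1")
  case True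
  then show ?thesis using assms by simp
next
  case False
  have "x * m powr (r - 1) \<le> x powr r / r + (m powr (r - 1)) powr (r / (r - 1)) / (r / (r - 1))"
    using assms False by (intro Youngs_inequality) (auto simp: field_simps)
  also have "(m powr (r - 1)) powr (r / (r - 1)) = m powr r"
    using False by (simp add: powr_powr)
  finally have "r * (x * m powr (r - 1)) \<le> r * (x powr r / r + m powr r / (r / (r - 1)))"
    using assms by (intro mult_left_mono) auto
  also have "\<dots> = x powr r + (r - 1) * m powr r"
    using assms by (simp add: field_simps)
  finally show ?thesis by (simp add: mult_ac)
qed

text \<open>Jensen's inequality for a weight \<open>k\<close> of mass at most \<open>B\<close>,
  without normalising it to a probability measure: the tangent inequality at one suitable point is
  integrated against \<open>k\<close>.\<close>

lemma nn_integral_jensen_epowr: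
  assumes [measurable]: "k \<in> borel_measurable M" "G \<in> borel_measurable M"
    and k: "(\<integral>\<^sup>+ x. k x \<partial>M) \<le> ennreal B" and "0 < B" "1 \<le> r"
  shows "epowr (\<integral>\<^sup>+ x. k x * G x \<partial>M) r \<le> ennreal (B powr (r - 1)) * (\<integral>\<^sup>+ x. k x * epowr (G x) r \<partial>M)"
    (is "_ \<le> _ * ?J")
proof (cases "\<integral>\<^sup>+ x. k x * G x \<partial>M")
  case top
  \<comment> \<open>As \<open>k\<close> has finite mass, this bound carries an infinite integral of
    \<open>k * G\<close> over to an infinite integral of \<open>k * epowr G r\<close>.\<close>
  have le: "y \<le> 1 + epowr y r" for y
  proof (cases y)
    case (real u)
    have "u \<le> 1 + u powr r"
      using powr_mono[of 1 r u] \<open>1 \<le> r\<close> real(1)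
      by (cases "u \<le> 1") (auto intro: add_increasing2)
    then show ?thesis
      using real ennreal_leI[of u "1 + u powr r"] by (simp add: epowr_ennreal ennreal_plus)
  qed (simp add: epowr_def)
  have "\<infinity> = (\<integral>\<^sup>+ x. k x * G x \<partial>M)" using top by simp
  also have "\<dots> \<le> (\<integral>\<^sup>+ x. k x + k x * epowr (G x) r \<partial>M)"
    using mult_left_mono[OF le] by (intro nn_integral_mono) (auto simp: distrib_left)
  also have "\<dots> = (\<integral>\<^sup>+ x. k x \<partial>M) + ?J" by (rule nn_integral_add) measurable
  finally have "?J = \<infinity>"
    using k by (auto simp: top_unique)
  then show ?thesis using \<open>0 < B\<close> by (simp add: ennreal_mult_top)
next
  case (real i)
  show ?thesis
  proof (cases "i = 0 \<or> ?J = \<infinity>")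
    case True
    then show ?thesis using real \<open>0 < B\<close> by (auto simp: ennreal_mult_top)
  next
    case False
    then obtain j where j: "?J = ennreal j" "0 \<le> j" by (cases ?J) auto
    have "0 < i" using False real by simp
    \<comment> \<open>The point of tangency is the mean of \<open>G\<close> that corresponds to mass
      exactly \<open>B\<close>. With \<open>i = m * B\<close> the tangent terms combine to
      \<open>m powr r * B \<le> j\<close>, which is the claim after multiplication by
      \<open>B powr (r - 1)\<close>.\<close>
    define m where "m = i / B"
    have "0 < m" using \<open>0 < i\<close> \<open>0 < B\<close> by (simp add: m_def)
    have "ennreal (r * m powr (r - 1)) * y \<le> epowr y r + ennreal ((r - 1) * m powr r)" for y
    proof (cases y)
      case (real u)
      then show ?thesis
        using ennreal_leI[OF powr_tangent[OF \<open>1 \<le> r\<close> real(1) \<open>0 < m\<close>]] \<open>1 \<le> r\<close>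
        by (simp add: epowr_ennreal ennreal_mult ennreal_plus)
    qed (simp add: epowr_def)
    then have *: "k x * (ennreal (r * m powr (r - 1)) * G x)
        \<le> k x * (epowr (G x) r + ennreal ((r - 1) * m powr r))" for x
      by (intro mult_left_mono) auto
    have "ennreal (r * m powr (r - 1) * i) = (\<integral>\<^sup>+ x. ennreal (r * m powr (r - 1)) * (k x * G x) \<partial>M)"
      using real \<open>1 \<le> r\<close> by (simp add: nn_integral_cmult ennreal_mult)
    also have "\<dots> \<le> (\<integral>\<^sup>+ x. k x * epowr (G x) r + ennreal ((r - 1) * m powr r) * k x \<partial>M)"
      using * by (intro nn_integral_mono) (auto simp: mult_ac distrib_left)
    also have "\<dots> = ?J + ennreal ((r - 1) * m powr r) * (\<integral>\<^sup>+ x. k x \<partial>M)"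
      by (simp add: nn_integral_add nn_integral_cmult)
    also have "\<dots> \<le> ennreal j + ennreal ((r - 1) * m powr r) * ennreal B"
      using k j by (intro add_mono mult_left_mono) auto
    also have "\<dots> = ennreal (j + (r - 1) * m powr r * B)"
      using j \<open>1 \<le> r\<close> \<open>0 < B\<close> by (simp add: ennreal_mult ennreal_plus)
    finally have "r * m powr (r - 1) * i \<le> j + (r - 1) * m powr r * B"
      using j \<open>1 \<le> r\<close> \<open>0 < B\<close> by (subst (asm) ennreal_le_iff) auto
    moreover have "r * m powr (r - 1) * i = r * (m powr r * B)"
      using \<open>0 < i\<close> \<open>0 < B\<close> by (simp add: m_def powr_diff)
    ultimately have "r * (m powr r * B) \<le> j + (r * (m powr r * B) - m powr r * B)"
      by (simp only: left_diff_distrib mult.assoc mult_1)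
    then have "m powr r * B \<le> j" by simp
    then have "B powr (r - 1) * (m powr r * B) \<le> B powr (r - 1) * j"
      by (intro mult_left_mono) auto
    moreover have "B powr (r - 1) * (m powr r * B) = i powr r"
      using \<open>0 < i\<close> \<open>0 < B\<close> by (simp add: m_def powr_diff powr_divide field_simps)
    ultimately show ?thesis
      using real j by (simp add: epowr_ennreal ennreal_mult[symmetric])
  qed
qed

section \<open>Distribution functions and decreasing rearrangements\<close>

lemma distrib_fun_le_add:
  assumes "\<Omega> \<in> sets lebesgue" and [measurable]: "f \<in> borel_measurable lebesgue" "g \<in> borel_measurable lebesgue"
    "h \<in> borel_measurable lebesgue"
    and "\<And>x. x \<in> \<Omega> \<Longrightarrow> h x = f x + g x"
  shows "distrib_fun \<Omega> h (a + b) \<le> distrib_fun \<Omega> f a + distrib_fun \<Omega> g b"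
proof -
  have [measurable]: "\<Omega> \<in> sets lebesgue" by fact
  have "distrib_fun \<Omega> h (a + b) \<le> emeasure lebesgue ({x \<in> \<Omega>. a < \<bar>f x\<bar>} \<union> {x \<in> \<Omega>. b < \<bar>g x\<bar>})"
    unfolding distrib_fun_def
    by (rule emeasure_mono) (use assms(5) in \<open>force\<close>, measurable)
  also have "\<dots> \<le> distrib_fun \<Omega> f a + distrib_fun \<Omega> g b"
    unfolding distrib_fun_def by (rule emeasure_subadditive) measurable
  finally show ?thesis .
qed

lemma rearr_le: "0 \<le> s \<Longrightarrow> distrib_fun \<Omega> f s \<le> ennreal t \<Longrightarrow> rearr \<Omega> f t \<le> s"
  unfolding rearr_def by (rule cInf_lower) (auto intro!: bdd_belowI[of _ 0])

lemma distrib_fun_antimono: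
  assumes "\<Omega> \<in> sets lebesgue" and [measurable]: "f \<in> borel_measurable lebesgue" and "s \<le> s'"
  shows "distrib_fun \<Omega> f s' \<le> distrib_fun \<Omega> f s"
proof -
  have [measurable]: "\<Omega> \<in> sets lebesgue" by fact
  show ?thesis
    unfolding distrib_fun_def by (rule emeasure_mono) (use assms(3) in \<open>force\<close>, measurable)
qed

text \<open>This makes the set under the \<open>Inf\<close> in \<open>rearr\<close> nonempty for
  \<open>t > 0\<close>. As \<open>f\<close> is real-valued, the sets where
  \<open>\<bar>f\<bar>\<close> exceeds \<open>n\<close> decrease to the empty set, and finite
  measure allows continuity from above.\<close>

lemma ex_distrib_fun_le:
  assumes "\<Omega> \<in> sets lebesgue" and [measurable]: "f \<in> borel_measurable lebesgue"
    and fin: "emeasure lebesgue \<Omega> < \<infinity>" and "0 < t"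
  shows "\<exists>s\<ge>0. distrib_fun \<Omega> f s \<le> ennreal t"
proof -
  have [measurable]: "\<Omega> \<in> sets lebesgue" by fact
  define A where "A n = {x \<in> \<Omega>. real n < \<bar>f x\<bar>}" for n
  have "(\<lambda>n. emeasure lebesgue (A n)) \<longlonglongrightarrow> emeasure lebesgue (\<Inter>n. A n)"
  proof (rule Lim_emeasure_decseq)
    have "A n \<in> sets lebesgue" for n unfolding A_def by measurable
    then show "range A \<subseteq> sets lebesgue" by auto
    show "decseq A" unfolding A_def by (force simp: decseq_def)
    show "emeasure lebesgue (A n) \<noteq> \<infinity>" for n
      using emeasure_mono[of "A n" \<Omega> lebesgue] fin assms(1) unfolding A_def
      by (auto simp: top_unique)
  qed
  moreover have "(\<Inter>n. A n) = {}"
    unfolding A_def using reals_Archimedean2 by (auto dest: order_less_asym)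
  ultimately have "(\<lambda>n. emeasure lebesgue (A n)) \<longlonglongrightarrow> 0" by simp
  then have "eventually (\<lambda>n. emeasure lebesgue (A n) < ennreal t) sequentially"
    by (rule order_tendstoD(2)) (simp add: \<open>0 < t\<close>)
  then obtain n where "emeasure lebesgue (A n) < ennreal t"
    by (auto simp: eventually_sequentially)
  then show ?thesis unfolding A_def distrib_fun_def
    by (intro exI[of _ "real n"]) auto
qed

text \<open>The strict superlevel set at \<open>s\<close> is the increasing union of those at
  \<open>s + 1 / (n + 1)\<close>. Right continuity is what makes the infimum defining
  \<open>rearr\<close> attained.\<close>

lemma distrib_fun_right_cont:
  assumes "\<Omega> \<in> sets lebesgue" and [measurable]: "f \<in> borel_measurable lebesgue"
    and le: "\<And>s'. s < s' \<Longrightarrow> distrib_fun \<Omega> f s' \<le> y"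
  shows "distrib_fun \<Omega> f s \<le> y"
proof -
  have [measurable]: "\<Omega> \<in> sets lebesgue" by fact
  define A where "A n = {x \<in> \<Omega>. s + 1 / Suc n < \<bar>f x\<bar>}" for n
  have "(SUP n. emeasure lebesgue (A n)) = emeasure lebesgue (\<Union>n. A n)"
  proof (rule SUP_emeasure_incseq)
    have "A n \<in> sets lebesgue" for n unfolding A_def by measurable
    then show "range A \<subseteq> sets lebesgue" by auto
    show "incseq A" unfolding A_def incseq_Suc_iff
      by (auto elim!: le_less_trans[rotated] simp: frac_le)
  qed
  moreover have "(\<Union>n. A n) = {x \<in> \<Omega>. s < \<bar>f x\<bar>}"
  proof -
    have "\<exists>n. s + 1 / Suc n < \<bar>f x\<bar>" if "s < \<bar>f x\<bar>" for x
      using reals_Archimedean[of "\<bar>f x\<bar> - s"] that by (auto simp: field_simps)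
    moreover have "s < \<bar>f x\<bar>" if "s + 1 / Suc n < \<bar>f x\<bar>" for x n
      using that by (smt (verit) divide_pos_pos of_nat_0_less_iff zero_less_Suc)
    ultimately show ?thesis unfolding A_def by blast
  qed
  moreover have "(SUP n. emeasure lebesgue (A n)) \<le> y"
    using le unfolding A_def distrib_fun_def by (intro SUP_least) auto
  ultimately show ?thesis unfolding distrib_fun_def by simp
qed

context
  fixes \<Omega> :: "'a::euclidean_space set"
  assumes \<Omega>: "\<Omega> \<in> sets lebesgue" "emeasure lebesgue \<Omega> < \<infinity>"
begin

lemma rearr_nonneg:
  assumes "f \<in> borel_measurable lebesgue" "0 < t"
  shows "0 \<le> rearr \<Omega> f t"
  using ex_distrib_fun_le[OF \<Omega>(1) assms(1) \<Omega>(2) assms(2)]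
  unfolding rearr_def by (intro cInf_greatest) auto

lemma distrib_fun_rearr_le:
  assumes "f \<in> borel_measurable lebesgue" "0 < t"
  shows "distrib_fun \<Omega> f (rearr \<Omega> f t) \<le> ennreal t"
proof (rule distrib_fun_right_cont[OF \<Omega>(1) assms(1)])
  fix s' assume "rearr \<Omega> f t < s'"
  then obtain s where "0 \<le> s" "distrib_fun \<Omega> f s \<le> ennreal t" "s < s'"
    using ex_distrib_fun_le[OF \<Omega>(1) assms(1) \<Omega>(2) assms(2)]
    unfolding rearr_def by (subst (asm) cInf_less_iff) (auto intro!: bdd_belowI[of _ 0])
  then show "distrib_fun \<Omega> f s' \<le> ennreal t"
    using distrib_fun_antimono[OF \<Omega>(1) assms(1), of s s'] by auto
qed

lemma rearr_antimono:
  assumes "f \<in> borel_measurable lebesgue" "0 < t" "t \<le> t'"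
  shows "rearr \<Omega> f t' \<le> rearr \<Omega> f t"
  using rearr_nonneg[OF assms(1,2)] distrib_fun_rearr_le[OF assms(1,2)] assms(3)
  by (intro rearr_le) (auto intro: order_trans ennreal_leI)

lemma rearr_add_le:
  assumes "f \<in> borel_measurable lebesgue" "g \<in> borel_measurable lebesgue"
    "h \<in> borel_measurable lebesgue" "\<And>x. x \<in> \<Omega> \<Longrightarrow> h x = f x + g x" "0 < s" "0 < t"
  shows "rearr \<Omega> h (s + t) \<le> rearr \<Omega> f s + rearr \<Omega> g t"
proof (rule rearr_le)
  show "0 \<le> rearr \<Omega> f s + rearr \<Omega> g t"
    using rearr_nonneg assms by simp
  have "distrib_fun \<Omega> h (rearr \<Omega> f s + rearr \<Omega> g t)
      \<le> distrib_fun \<Omega> f (rearr \<Omega> f s) + distrib_fun \<Omega> g (rearr \<Omega> g t)"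
    by (rule distrib_fun_le_add) (use \<Omega> assms in auto)
  also have "\<dots> \<le> ennreal s + ennreal t"
    using assms by (intro add_mono distrib_fun_rearr_le) auto
  finally show "distrib_fun \<Omega> h (rearr \<Omega> f s + rearr \<Omega> g t) \<le> ennreal (s + t)"
    using assms by simp
qed

lemma rearr_mono_fun:
  assumes "f \<in> borel_measurable lebesgue" "g \<in> borel_measurable lebesgue"
    "\<And>x. x \<in> \<Omega> \<Longrightarrow> \<bar>f x\<bar> \<le> \<bar>g x\<bar>" "0 < t"
  shows "rearr \<Omega> f t \<le> rearr \<Omega> g t"
proof (rule rearr_le)
  show "0 \<le> rearr \<Omega> g t" using rearr_nonneg assms by simp
  have [measurable]: "\<Omega> \<in> sets lebesgue" "g \<in> borel_measurable lebesgue" by fact+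
  have "distrib_fun \<Omega> f (rearr \<Omega> g t) \<le> distrib_fun \<Omega> g (rearr \<Omega> g t)"
    unfolding distrib_fun_def by (rule emeasure_mono) (use assms(3) in \<open>force\<close>, measurable)
  also have "\<dots> \<le> ennreal t" using assms by (intro distrib_fun_rearr_le) auto
  finally show "distrib_fun \<Omega> f (rearr \<Omega> g t) \<le> ennreal t" .
qed

text \<open>Monotonicity is available only for \<open>t > 0\<close>. For \<open>t \<le> 0\<close>
  the set under the \<open>Inf\<close> may be empty and its value unspecified, but
  \<open>ennreal t = 0\<close> makes that value independent of \<open>t\<close>, so the two
  half-lines are treated separately.\<close>

lemma borel_measurable_rearr:
  assumes "f \<in> borel_measurable lebesgue"
  shows "rearr \<Omega> f \<in> borel_measurable borel"
proof (rule measurable_piecewise_restrict[of "{{..0}, {0<..}}"])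
  fix C :: "real set" assume "C \<in> {{..0}, {0<..}}"
  then consider "C = {..0}" | "C = {0<..}" by auto
  then show "rearr \<Omega> f \<in> borel_measurable (restrict_space borel C)"
  proof cases
    case 1
    have "rearr \<Omega> f t = rearr \<Omega> f 0" if "t \<in> space (restrict_space borel C)" for t
      using that unfolding 1 by (simp add: rearr_def ennreal_neg space_restrict_space)
    then show ?thesis
      using borel_measurable_const by (subst measurable_cong) auto
  next
    case 2
    have "(\<lambda>t. - rearr \<Omega> f t) \<in> borel_measurable (restrict_space borel C)"
      unfolding 2 by (rule borel_measurable_mono_on_fnc) (auto simp: mono_on_def rearr_antimono assms)
    then show ?thesis by simp
  qed
qed auto

text \<open>The part of \<open>g\<close> above the level \<open>rearr \<Omega> g s\<close> lives on
  a set of measure at most \<open>s\<close>, because the infimum in \<open>rearr\<close> is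
  attained.\<close>

lemma rearr_upper_part:
  assumes "g \<in> borel_measurable lebesgue" "0 < s" "s \<le> t"
  shows "rearr \<Omega> (\<lambda>x. if \<bar>g x\<bar> > rearr \<Omega> g s then g x else 0) t = 0"
proof (rule antisym)
  have [measurable]: "g \<in> borel_measurable lebesgue" by fact
  show "0 \<le> rearr \<Omega> (\<lambda>x. if \<bar>g x\<bar> > rearr \<Omega> g s then g x else 0) t"
    by (rule rearr_nonneg) (use assms in auto)
  have "{x \<in> \<Omega>. 0 < \<bar>if \<bar>g x\<bar> > rearr \<Omega> g s then g x else 0\<bar>} = {x \<in> \<Omega>. rearr \<Omega> g s < \<bar>g x\<bar>}"
    using rearr_nonneg[OF assms(1,2)] by (auto split: if_splits)
  then have "distrib_fun \<Omega> (\<lambda>x. if \<bar>g x\<bar> > rearr \<Omega> g s then g x else 0) 0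
      = distrib_fun \<Omega> g (rearr \<Omega> g s)"
    by (simp add: distrib_fun_def)
  also have "\<dots> \<le> ennreal s" using assms by (intro distrib_fun_rearr_le) auto
  also have "\<dots> \<le> ennreal t" using assms by (intro ennreal_leI)
  finally show "rearr \<Omega> (\<lambda>x. if \<bar>g x\<bar> > rearr \<Omega> g s then g x else 0) t \<le> 0"
    by (intro rearr_le) auto
qed

lemma rearr_lower_part:
  assumes "0 \<le> c"
  shows "rearr \<Omega> (\<lambda>x. if \<bar>g x\<bar> > c then 0 else g x) t \<le> c"
proof (rule rearr_le)
  have "{x \<in> \<Omega>. c < \<bar>if \<bar>g x\<bar> > c then 0 else g x\<bar>} = {}" using assms by auto
  then show "distrib_fun \<Omega> (\<lambda>x. if \<bar>g x\<bar> > c then 0 else g x) c \<le> ennreal t"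
    unfolding distrib_fun_def by (simp only: emeasure_empty) simp
qed fact

end

section \<open>Endpoint norms against Lorentz and Marcinkiewicz norms\<close>

definition lg :: "real \<Rightarrow> real" where "lg t = 1 - ln t"

lemma lg_ge_1: "0 < t \<Longrightarrow> t \<le> 1 \<Longrightarrow> 1 \<le> lg t"
  by (simp add: lg_def)

lemma lg_antimono: "0 < s \<Longrightarrow> s \<le> t \<Longrightarrow> lg t \<le> lg s"
  by (simp add: lg_def)

text \<open>Halving the argument adds \<open>ln 2 \<le> 1 \<le> lg u\<close>: the logarithm varies
  slowly, so dyadic comparisons cost only constants.\<close>

lemma lg_doubling:
  assumes "0 < u" "u \<le> 1" "u / 2 \<le> v"
  shows "lg v \<le> 2 * lg u"
proof -
  have "lg v \<le> lg (u / 2)" using assms by (intro lg_antimono) auto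
  also have "\<dots> = lg u + ln 2" using assms by (simp add: lg_def ln_div)
  also have "ln (2::real) \<le> 1" using ln_le_minus_one[of 2] by simp
  finally show ?thesis using lg_ge_1[OF assms(1,2)] by simp
qed

lemma lg_powr_doubling:
  assumes u: "0 < u" "u \<le> 1" "u / 2 \<le> v" "v \<le> u" and q: "1 < q"
  shows "lg u powr (- (1 / q)) \<le> 2 * lg v powr (- (1 / q))"
proof -
  have "1 \<le> lg v" using u by (intro lg_ge_1) auto
  have "lg u powr (- (1 / q)) \<le> (lg v / 2) powr (- (1 / q))"
    using u q lg_doubling[of u v] \<open>1 \<le> lg v\<close> by (intro powr_mono2') auto
  also have "\<dots> = 2 powr (1 / q) * lg v powr (- (1 / q))"
    using \<open>1 \<le> lg v\<close> by (simp add: powr_divide powr_minus field_simps)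
  also have "\<dots> \<le> 2 powr 1 * lg v powr (- (1 / q))"
    using q by (intro mult_right_mono powr_mono) auto
  finally show ?thesis by simp
qed

lemma measurable_lg [measurable]: "lg \<in> borel_measurable borel"
  unfolding lg_def[abs_def] by measurable

lemma DERIV_lg_powr:
  assumes "0 < t" "t \<le> 1"
  shows "((\<lambda>t. - (lg t powr (1 - b))) has_real_derivative (1 - b) * (lg t powr (- b) / t)) (at t)"
proof -
  have "(lg has_real_derivative - 1 / t) (at t)"
    using assms unfolding lg_def[abs_def] by (auto intro!: derivative_eq_intros)
  then have "((\<lambda>t. lg t powr (1 - b)) has_real_derivative
      (1 - b) * lg t powr (1 - b - of_nat 1) * (- 1 / t)) (at t)"
    using lg_ge_1[OF assms] by (intro DERIV_fun_powr) auto
  from DERIV_minus[OF this] show ?thesis by simp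
qed

text \<open>With \<open>b = 1 / p\<close> this is the outer integral of the small norm over
  \<open>t > u\<close> and the origin of the factor \<open>lg u powr (1 - 1 / p)\<close> in
  \<open>phi_small\<close>. The term \<open>- 1\<close> is dropped in the upper bound and has to be
  absorbed in the lower one.\<close>

lemma nn_integral_lg_powr:
  assumes "0 < u" "u \<le> 1" "b < 1"
  shows "(\<integral>\<^sup>+ t. indicator {u<..<1} t * ennreal (lg t powr (- b) / t) \<partial>lborel)
    = ennreal ((lg u powr (1 - b) - 1) / (1 - b))"
proof -
  have "AE t in lborel. t \<noteq> u \<and> t \<noteq> 1"
    by (intro AE_conjI AE_lborel_singleton)
  then have "(\<integral>\<^sup>+ t. indicator {u<..<1} t * ennreal (lg t powr (- b) / t) \<partial>lborel)
     = (\<integral>\<^sup>+ t. ennreal (lg t powr (- b) / t) * indicator {u..1} t \<partial>lborel)"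
    by (intro nn_integral_cong_AE, elim eventually_mono) (auto split: split_indicator)
  also have "\<dots> = ennreal (- (lg 1 powr (1 - b)) / (1 - b) - (- (lg u powr (1 - b))) / (1 - b))"
  proof (rule nn_integral_FTC_Icc)
    fix t assume t: "t \<in> {u..1}"
    then have "((\<lambda>t. - (lg t powr (1 - b)) / (1 - b)) has_real_derivative
        ((1 - b) * (lg t powr (- b) / t)) / (1 - b)) (at t)"
      using assms by (intro DERIV_cdivide DERIV_lg_powr) auto
    then show "((\<lambda>t. - (lg t powr (1 - b)) / (1 - b)) has_real_derivative
        (lg t powr (- b) / t)) (at t)"
      using assms by simp
    show "0 \<le> lg t powr (- b) / t" using t assms by simp
  qed (use assms in auto)
  also have "lg 1 = 1" by (simp add: lg_def)
  finally show ?thesis by (simp add: diff_divide_distrib)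
qed

text \<open>
  The factor \<open>w * h\<close> need not be monotone, but doubling of \<open>w\<close> gives
  \<open>w u * h u * u powr (1 / p) \<le> 2 * D * F\<close>, where \<open>F\<close> is the integral on the right; then
  \<open>(w * h) powr p\<close> splits off \<open>p - 1\<close> factors bounded in this way.
\<close>

lemma lorentz_norm_bound:
  fixes h w :: "real \<Rightarrow> real"
  assumes [measurable]: "h \<in> borel_measurable borel" "w \<in> borel_measurable borel"
    and h0: "\<And>u. 0 < u \<Longrightarrow> 0 \<le> h u" and mono: "\<And>u v. 0 < u \<Longrightarrow> u \<le> v \<Longrightarrow> h v \<le> h u"
    and w0: "\<And>u. 0 < u \<Longrightarrow> u < 1 \<Longrightarrow> 0 \<le> w u"
    and D: "\<And>u v. 0 < u \<Longrightarrow> u < 1 \<Longrightarrow> u / 2 < v \<Longrightarrow> v < u \<Longrightarrow> w u \<le> D * w v" "1 \<le> D"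
    and p: "1 \<le> p" and t: "t \<le> 1"
  shows "epowr (\<integral>\<^sup>+ u. indicator {0<..<t} u * ennreal ((w u * h u) powr p) \<partial>lborel) (1 / p)
     \<le> ennreal (2 * D) * (\<integral>\<^sup>+ u. indicator {0<..<t} u * ennreal (w u * h u * u powr (1 / p - 1)) \<partial>lborel)"
    (is "epowr ?I _ \<le> _ * ?F")
proof (cases "?F")
  case top
  then show ?thesis using D(2) by (simp add: ennreal_mult_top)
next
  case (real F)
  have point: "w u * h u * u powr (1 / p) \<le> 2 * D * F" if u: "0 < u" "u < t" for u
  proof -
    \<comment> \<open>\<open>c\<close> bounds the integrand of \<open>?F\<close> from below on
      \<open>(u / 2, u)\<close>: there \<open>h\<close> and \<open>u powr (1 / p - 1)\<close> are at
      least their values at \<open>u\<close>, and \<open>w\<close> loses at most the factor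
      \<open>D\<close>. The length \<open>u / 2\<close> supplies the missing power of
      \<open>u\<close>.\<close>
    define c where "c = w u * h u * u powr (1 / p - 1) / D"
    have "0 \<le> c" using u t D(2) h0[of u] w0[of u] by (simp add: c_def)
    have "indicator {u/2<..<u} v * ennreal c
        \<le> indicator {0<..<t} v * ennreal (w v * h v * v powr (1 / p - 1))" for v
    proof (cases "v \<in> {u/2<..<u}")
      case True
      have "w u \<le> D * w v" "h u \<le> h v" "u powr (1 / p - 1) \<le> v powr (1 / p - 1)"
        using True u t p D(1)[of u v] mono[of v u] by (auto intro!: powr_mono2')
      then have "w u * h u * u powr (1 / p - 1) \<le> D * w v * h v * v powr (1 / p - 1)"
        using u t True h0[of u] w0[of v] w0[of u] D(2) by (intro mult_mono) auto
      then have "c \<le> w v * h v * v powr (1 / p - 1)"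
        using D(2) by (simp add: c_def field_simps)
      then show ?thesis using True u by (auto simp: ennreal_leI)
    qed simp
    then have "(\<integral>\<^sup>+ v. indicator {u/2<..<u} v * ennreal c \<partial>lborel) \<le> ?F"
      by (rule nn_integral_mono)
    also have "(\<integral>\<^sup>+ v. indicator {u/2<..<u} v * ennreal c \<partial>lborel) = ennreal (c * (u / 2))"
      using u \<open>0 \<le> c\<close> by (simp add: mult.commute nn_integral_cmult ennreal_mult[symmetric])
    finally have "c * (u / 2) \<le> F" using real by simp
    moreover have "c * (u / 2) = w u * h u * u powr (1 / p) / (2 * D)"
      using u by (simp add: c_def powr_diff)
    ultimately have "w u * h u * u powr (1 / p) / (2 * D) \<le> F" by simp
    then show ?thesis using D(2) by (simp add: pos_divide_le_eq mult_ac)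
  qed
  have "indicator {0<..<t} u * ennreal ((w u * h u) powr p)
      \<le> ennreal ((2 * D * F) powr (p - 1)) * (indicator {0<..<t} u * ennreal (w u * h u * u powr (1 / p - 1)))" for u
  proof (cases "0 < u \<and> u < t")
    case True
    then have y: "0 \<le> w u * h u" using t h0[of u] w0[of u] by simp
    have "(w u * h u) powr p = (w u * h u) * (w u * h u) powr (p - 1)"
      using y p by (simp add: powr_mult_base)
    also have "\<dots> = (w u * h u * u powr (1 / p - 1)) * (w u * h u * u powr (1 / p)) powr (p - 1)"
    proof -
      have "u powr (1 / p - 1) * u powr ((p - 1) / p) = 1"
        using True p by (simp add: powr_add[symmetric] diff_divide_distrib)
      moreover have "(w u * h u * u powr (1 / p)) powr (p - 1)
          = (w u * h u) powr (p - 1) * u powr ((p - 1) / p)"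
        using y by (subst powr_mult) (auto simp: powr_powr)
      ultimately show ?thesis by (simp add: mult_ac)
    qed
    also have "\<dots> \<le> (w u * h u * u powr (1 / p - 1)) * (2 * D * F) powr (p - 1)"
      using True y p point[of u] by (intro mult_left_mono powr_mono2) auto
    finally have "ennreal ((w u * h u) powr p)
        \<le> ennreal ((w u * h u * u powr (1 / p - 1)) * (2 * D * F) powr (p - 1))"
      by (rule ennreal_leI)
    also have "\<dots> = ennreal (w u * h u * u powr (1 / p - 1)) * ennreal ((2 * D * F) powr (p - 1))"
      using y by (intro ennreal_mult) auto
    finally show ?thesis using True by (simp add: mult_ac)
  qed auto
  then have "?I \<le> (\<integral>\<^sup>+ u. ennreal ((2 * D * F) powr (p - 1)) *
      (indicator {0<..<t} u * ennreal (w u * h u * u powr (1 / p - 1))) \<partial>lborel)"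
    by (rule nn_integral_mono)
  also have "\<dots> = ennreal ((2 * D * F) powr (p - 1) * F)"
    using real by (simp add: nn_integral_cmult ennreal_mult)
  also have "\<dots> \<le> ennreal ((2 * D * F) powr p)"
  proof (rule ennreal_leI)
    have "(2 * D * F) powr (p - 1) * F \<le> (2 * D * F) powr (p - 1) * (2 * D * F)"
      using real D(2) mult_right_mono[of 1 "2 * D" F] by (intro mult_left_mono) auto
    also have "\<dots> = (2 * D * F) powr p"
      using real D(2) p by (simp add: powr_mult_base mult.commute[of _ "2 * D * F"])
    finally show "(2 * D * F) powr (p - 1) * F \<le> (2 * D * F) powr p" .
  qed
  finally have "epowr ?I (1 / p) \<le> epowr (ennreal ((2 * D * F) powr p)) (1 / p)"
    using p by (intro epowr_mono) auto
  also have "\<dots> = ennreal (2 * D * F)"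
    using real D(2) p by (simp add: epowr_ennreal powr_powr)
  finally show ?thesis using real D(2) by (simp add: ennreal_mult)
qed

section \<open>Fundamental functions and upper bounds for the endpoint norms\<close>

definition phi_small :: "real \<Rightarrow> real \<Rightarrow> real" where
  "phi_small p u = u powr (1 / p) * lg u powr (1 - 1 / p)"

definition phi_grand :: "real \<Rightarrow> real \<Rightarrow> real" where
  "phi_grand q u = u powr (1 / q) * lg u powr (- (1 / q))"

lemma measurable_phi [measurable]:
  "phi_small p \<in> borel_measurable borel" "phi_grand p \<in> borel_measurable borel"
  unfolding phi_small_def[abs_def] phi_grand_def[abs_def] by measurable

text \<open>The right side is the quantity that the grand norm sees at \<open>t = u / 2\<close>,
  through the interval \<open>(u / 2, u)\<close>. One factor 2 comes from the power and one from the
  logarithm.\<close>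

lemma phi_grand_half:
  assumes q: "1 < q" and u: "0 < u" "u \<le> 1"
  shows "phi_grand q u \<le> 4 * ((u / 2) powr (1 / q) * lg (u / 2) powr (- (1 / q)))"
proof -
  have "(2::real) powr (1 / q) \<le> 2 powr 1" using q by (intro powr_mono) auto
  then have "u powr (1 / q) \<le> 2 * (u / 2) powr (1 / q)"
    using u by (simp add: powr_divide field_simps)
  moreover have "lg u powr (- (1 / q)) \<le> 2 * lg (u / 2) powr (- (1 / q))"
    using u q by (intro lg_powr_doubling) auto
  ultimately have "phi_grand q u \<le> (2 * (u / 2) powr (1 / q)) * (2 * lg (u / 2) powr (- (1 / q)))"
    unfolding phi_grand_def by (intro mult_mono) auto
  then show ?thesis by simp
qed

context
  fixes \<Omega> :: "'a::euclidean_space set"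
  assumes \<Omega>: "\<Omega> \<in> sets lebesgue" "emeasure lebesgue \<Omega> < \<infinity>"
begin

text \<open>The inner \<open>L^p\<close> norm is bounded by the integral of
  \<open>rearr \<Omega> f u * u powr (1 / p - 1)\<close>, which is linear in the rearrangement.
  Tonelli then moves the weight in \<open>t\<close> inside, where its integral over
  \<open>(u, 1)\<close> is at most \<open>p / (p - 1) * lg u powr (1 - 1 / p)\<close>.\<close>

lemma small_leb_norm_le:
  assumes f: "f \<in> borel_measurable lebesgue" and p: "1 < p"
  shows "small_leb_norm \<Omega> p f \<le> ennreal (2 * p / (p - 1)) *
    (\<integral>\<^sup>+ u. indicator {0<..<1} u * ennreal (phi_small p u * rearr \<Omega> f u / u) \<partial>lborel)"
proof -
  have [measurable]: "rearr \<Omega> f \<in> borel_measurable borel"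
    by (rule borel_measurable_rearr[OF \<Omega> f])
  define F where "F u = ennreal (rearr \<Omega> f u * u powr (1 / p - 1))" for u
  have [measurable]: "F \<in> borel_measurable borel" unfolding F_def[abs_def] by measurable
  define k where "k t = ennreal (lg t powr (- (1 / p)) / t)" for t
  have [measurable]: "k \<in> borel_measurable borel" unfolding k_def[abs_def] by measurable
  have inner: "epowr (\<integral>\<^sup>+ s. indicator {0<..<t} s * ennreal (rearr \<Omega> f s powr p) \<partial>lborel) (1 / p)
      \<le> 2 * (\<integral>\<^sup>+ u. indicator {0<..<t} u * F u \<partial>lborel)" if "t \<le> 1" for t
    using lorentz_norm_bound[of "rearr \<Omega> f" "\<lambda>_. 1" 1 p t] p that
      rearr_nonneg[OF \<Omega> f] rearr_antimono[OF \<Omega> f] by (simp add: F_def)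
  have "small_leb_norm \<Omega> p f \<le> (\<integral>\<^sup>+ t. 2 * (indicator {0<..<1} t * k t *
      (\<integral>\<^sup>+ u. indicator {0<..<t} u * F u \<partial>lborel)) \<partial>lborel)"
    unfolding small_leb_norm_def
  proof (rule nn_integral_mono)
    fix t :: real
    show "indicator {0<..<1} t * ennreal ((1 - ln t) powr (- 1 / p) / t) *
        epowr (\<integral>\<^sup>+ s. indicator {0<..<t} s * ennreal (rearr \<Omega> f s powr p) \<partial>lborel) (1 / p)
      \<le> 2 * (indicator {0<..<1} t * k t * (\<integral>\<^sup>+ u. indicator {0<..<t} u * F u \<partial>lborel))"
      using mult_left_mono[OF inner[of t], of "k t"]
      by (cases "t \<in> {0<..<1}") (auto simp: k_def lg_def mult_ac)
  qed
  also have "\<dots> = 2 * (\<integral>\<^sup>+ t. indicator {0<..<1} t * k t *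
      (\<integral>\<^sup>+ u. indicator {0<..<t} u * F u \<partial>lborel) \<partial>lborel)"
  proof (rule nn_integral_cmult)
    \<comment> \<open>The moving interval \<open>(0, t)\<close> is written as a section of a fixed
      subset of the plane, so that joint measurability can be read off.\<close>
    have "(\<lambda>t. \<integral>\<^sup>+ u. indicator {x. 0 < snd x \<and> snd x < fst x} (t, u) * F u \<partial>lborel) \<in> borel_measurable borel"
      by measurable
    moreover have "(\<lambda>t. \<integral>\<^sup>+ u. indicator {x. 0 < snd x \<and> snd x < fst x} (t, u) * F u \<partial>lborel)
        = (\<lambda>t. \<integral>\<^sup>+ u. indicator {0<..<t} u * F u \<partial>lborel)"
      by (intro ext nn_integral_cong) (auto split: split_indicator)
    ultimately show "(\<lambda>t. indicator {0<..<1} t * k t * (\<integral>\<^sup>+ u. indicator {0<..<t} u * F u \<partial>lborel))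
      \<in> borel_measurable lborel" by simp
  qed
  also have "(\<integral>\<^sup>+ t. indicator {0<..<1} t * k t * (\<integral>\<^sup>+ u. indicator {0<..<t} u * F u \<partial>lborel) \<partial>lborel)
      = (\<integral>\<^sup>+ t. (\<integral>\<^sup>+ u. indicator {x. 0 < snd x \<and> snd x < fst x \<and> fst x < 1} (t, u) * (k t * F u) \<partial>lborel) \<partial>lborel)"
    by (intro nn_integral_cong, subst nn_integral_cmult[symmetric], measurable)
      (auto intro!: nn_integral_cong split: split_indicator)
  also have "\<dots> = (\<integral>\<^sup>+ u. (\<integral>\<^sup>+ t. indicator {x. 0 < snd x \<and> snd x < fst x \<and> fst x < 1} (t, u) * (k t * F u) \<partial>lborel) \<partial>lborel)"
    by (rule lborel_pair.Fubini'[symmetric]) measurable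
  also have "\<dots> = (\<integral>\<^sup>+ u. indicator {0<..<1} u * F u * (\<integral>\<^sup>+ t. indicator {u<..<1} t * k t \<partial>lborel) \<partial>lborel)"
    by (intro nn_integral_cong, subst nn_integral_cmult[symmetric], measurable)
      (auto intro!: nn_integral_cong split: split_indicator simp: mult_ac)
  also have "\<dots> \<le> (\<integral>\<^sup>+ u. ennreal (p / (p - 1)) *
      (indicator {0<..<1} u * ennreal (phi_small p u * rearr \<Omega> f u / u)) \<partial>lborel)"
  proof (rule nn_integral_mono)
    fix u :: real
    show "indicator {0<..<1} u * F u * (\<integral>\<^sup>+ t. indicator {u<..<1} t * k t \<partial>lborel)
      \<le> ennreal (p / (p - 1)) * (indicator {0<..<1} u * ennreal (phi_small p u * rearr \<Omega> f u / u))"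
    proof (cases "u \<in> {0<..<1}")
      case True
      have "(\<integral>\<^sup>+ t. indicator {u<..<1} t * k t \<partial>lborel)
          = ennreal ((lg u powr (1 - 1 / p) - 1) / (1 - 1 / p))"
        unfolding k_def using True p by (intro nn_integral_lg_powr) auto
      also have "\<dots> \<le> ennreal (lg u powr (1 - 1 / p) / (1 - 1 / p))"
        using p by (intro ennreal_leI divide_right_mono) auto
      also have "lg u powr (1 - 1 / p) / (1 - 1 / p) = p / (p - 1) * lg u powr (1 - 1 / p)"
        using p by (simp add: field_simps)
      finally have "F u * (\<integral>\<^sup>+ t. indicator {u<..<1} t * k t \<partial>lborel)
          \<le> F u * ennreal (p / (p - 1) * lg u powr (1 - 1 / p))"
        by (rule mult_left_mono) simp
      also have "\<dots> = ennreal (rearr \<Omega> f u * u powr (1 / p - 1) * (p / (p - 1) * lg u powr (1 - 1 / p)))"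
        using True p rearr_nonneg[OF \<Omega> f, of u] unfolding F_def by (subst ennreal_mult) auto
      also have "rearr \<Omega> f u * u powr (1 / p - 1) * (p / (p - 1) * lg u powr (1 - 1 / p))
          = p / (p - 1) * (phi_small p u * rearr \<Omega> f u / u)"
        using True by (simp add: phi_small_def powr_diff mult_ac)
      also have "ennreal (p / (p - 1) * (phi_small p u * rearr \<Omega> f u / u))
          = ennreal (p / (p - 1)) * ennreal (phi_small p u * rearr \<Omega> f u / u)"
        using True p rearr_nonneg[OF \<Omega> f, of u] by (intro ennreal_mult) (auto simp: phi_small_def)
      finally show ?thesis using True by simp
    qed simp
  qed
  also have "\<dots> = ennreal (p / (p - 1)) *
      (\<integral>\<^sup>+ u. indicator {0<..<1} u * ennreal (phi_small p u * rearr \<Omega> f u / u) \<partial>lborel)"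
    by (rule nn_integral_cmult) measurable
  finally have "small_leb_norm \<Omega> p f \<le> 2 * (ennreal (p / (p - 1)) *
      (\<integral>\<^sup>+ u. indicator {0<..<1} u * ennreal (phi_small p u * rearr \<Omega> f u / u) \<partial>lborel))"
    by (simp add: mult_left_mono)
  also have "\<dots> = ennreal (2 * p / (p - 1)) *
      (\<integral>\<^sup>+ u. indicator {0<..<1} u * ennreal (phi_small p u * rearr \<Omega> f u / u) \<partial>lborel)"
    using p ennreal_mult[of 2 "p / (p - 1)"] by (simp add: mult.assoc[symmetric])
  finally show ?thesis .
qed

text \<open>For \<open>u > t\<close> the weight \<open>lg t powr (- (1 / q))\<close> is at most
  \<open>lg u powr (- (1 / q))\<close>. Pulled inside the integral, it removes the supremum: every
  \<open>t\<close> is dominated by one weighted \<open>L^q\<close> norm on \<open>(0, 1)\<close>, to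
  which \<open>lorentz_norm_bound\<close> applies with \<open>D = 2\<close>.\<close>

lemma grand_leb_norm_le:
  assumes f: "f \<in> borel_measurable lebesgue" and q: "1 < q"
  shows "grand_leb_norm \<Omega> q f \<le> ennreal 4 *
    (\<integral>\<^sup>+ u. indicator {0<..<1} u * ennreal (phi_grand q u * rearr \<Omega> f u / u) \<partial>lborel)"
  unfolding grand_leb_norm_def
proof (rule SUP_least)
  have [measurable]: "rearr \<Omega> f \<in> borel_measurable borel"
    by (rule borel_measurable_rearr[OF \<Omega> f])
  fix t :: real assume t: "t \<in> {0<..<1}"
  define c where "c = lg t powr (- 1 / q)"
  have "0 < c" using t lg_ge_1[of t] by (simp add: c_def)
  have "c * epowr (\<integral>\<^sup>+ s. indicator {t<..<1} s * ennreal (rearr \<Omega> f s powr q) \<partial>lborel) (1 / q)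
      = epowr (ennreal (c powr q) * (\<integral>\<^sup>+ s. indicator {t<..<1} s * ennreal (rearr \<Omega> f s powr q) \<partial>lborel)) (1 / q)"
    using q \<open>0 < c\<close> by (subst epowr_cmult) (auto simp: powr_powr)
  also have "\<dots> = epowr (\<integral>\<^sup>+ s. ennreal (c powr q) * (indicator {t<..<1} s * ennreal (rearr \<Omega> f s powr q)) \<partial>lborel) (1 / q)"
    by (subst nn_integral_cmult) auto
  also have "\<dots> \<le> epowr (\<integral>\<^sup>+ u. indicator {0<..<1} u * ennreal ((lg u powr (- (1 / q)) * rearr \<Omega> f u) powr q) \<partial>lborel) (1 / q)"
  proof (intro epowr_mono nn_integral_mono)
    fix u :: real
    show "ennreal (c powr q) * (indicator {t<..<1} u * ennreal (rearr \<Omega> f u powr q))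
      \<le> indicator {0<..<1} u * ennreal ((lg u powr (- (1 / q)) * rearr \<Omega> f u) powr q)"
    proof (cases "u \<in> {t<..<1}")
      case True
      have "c \<le> lg u powr (- (1 / q))"
        unfolding c_def using True t q lg_antimono[of t u] lg_ge_1[of u]
        by (auto intro!: powr_mono2')
      then have "(c * rearr \<Omega> f u) powr q \<le> (lg u powr (- (1 / q)) * rearr \<Omega> f u) powr q"
        using True t q \<open>0 < c\<close> rearr_nonneg[OF \<Omega> f, of u] by (intro powr_mono2 mult_right_mono) auto
      then have "ennreal ((c * rearr \<Omega> f u) powr q) \<le> ennreal ((lg u powr (- (1 / q)) * rearr \<Omega> f u) powr q)"
        by (rule ennreal_leI)
      moreover have "ennreal (c powr q) * ennreal (rearr \<Omega> f u powr q) = ennreal ((c * rearr \<Omega> f u) powr q)"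
        using True t \<open>0 < c\<close> rearr_nonneg[OF \<Omega> f, of u] by (simp add: ennreal_mult powr_mult)
      ultimately show ?thesis using True t by simp
    qed simp
  qed (use q in auto)
  also have "\<dots> \<le> ennreal (2 * 2) * (\<integral>\<^sup>+ u. indicator {0<..<1} u *
      ennreal (lg u powr (- (1 / q)) * rearr \<Omega> f u * u powr (1 / q - 1)) \<partial>lborel)"
  proof (rule lorentz_norm_bound)
    fix u v :: real assume uv: "0 < u" "u < 1" "u / 2 < v" "v < u"
    show "lg u powr (- (1 / q)) \<le> 2 * lg v powr (- (1 / q))"
      using uv q by (intro lg_powr_doubling) auto
  qed (use q rearr_nonneg[OF \<Omega> f] rearr_antimono[OF \<Omega> f] in auto)
  also have "(\<integral>\<^sup>+ u. indicator {0<..<1} u *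
      ennreal (lg u powr (- (1 / q)) * rearr \<Omega> f u * u powr (1 / q - 1)) \<partial>lborel)
      = (\<integral>\<^sup>+ u. indicator {0<..<1} u * ennreal (phi_grand q u * rearr \<Omega> f u / u) \<partial>lborel)"
    by (intro nn_integral_cong) (auto split: split_indicator simp: phi_grand_def powr_diff mult_ac)
  finally show "ennreal ((1 - ln t) powr (- 1 / q)) *
      epowr (\<integral>\<^sup>+ s. indicator {t<..<1} s * ennreal (rearr \<Omega> f s powr q) \<partial>lborel) (1 / q)
     \<le> ennreal 4 * (\<integral>\<^sup>+ u. indicator {0<..<1} u * ennreal (phi_grand q u * rearr \<Omega> f u / u) \<partial>lborel)"
    by (simp add: c_def lg_def)
qed

section \<open>Lower bounds for the endpoint norms\<close>

lemma nn_integral_rearr_powr_ge: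
  assumes f: "f \<in> borel_measurable lebesgue" and p: "0 < p" and "0 \<le> a" "a < u" "u \<le> b"
  shows "ennreal ((u - a) powr (1 / p) * rearr \<Omega> f u)
     \<le> epowr (\<integral>\<^sup>+ s. indicator {a<..<b} s * ennreal (rearr \<Omega> f s powr p) \<partial>lborel) (1 / p)"
proof -
  have h: "0 \<le> rearr \<Omega> f u" using rearr_nonneg[OF \<Omega> f, of u] assms by simp
  have "indicator {a<..<u} s * ennreal (rearr \<Omega> f u powr p)
      \<le> indicator {a<..<b} s * ennreal (rearr \<Omega> f s powr p)" for s
    using assms h rearr_antimono[OF \<Omega> f, of s u]
    by (auto split: split_indicator intro!: ennreal_leI powr_mono2)
  then have "(\<integral>\<^sup>+ s. indicator {a<..<u} s * ennreal (rearr \<Omega> f u powr p) \<partial>lborel)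
      \<le> (\<integral>\<^sup>+ s. indicator {a<..<b} s * ennreal (rearr \<Omega> f s powr p) \<partial>lborel)"
    by (rule nn_integral_mono)
  moreover have "(\<integral>\<^sup>+ s. indicator {a<..<u} s * ennreal (rearr \<Omega> f u powr p) \<partial>lborel)
      = ennreal ((u - a) * rearr \<Omega> f u powr p)"
    using assms by (simp add: nn_integral_multc ennreal_mult)
  ultimately have "epowr (ennreal ((u - a) * rearr \<Omega> f u powr p)) (1 / p)
     \<le> epowr (\<integral>\<^sup>+ s. indicator {a<..<b} s * ennreal (rearr \<Omega> f s powr p) \<partial>lborel) (1 / p)"
    using p by (intro epowr_mono) auto
  then show ?thesis
    using assms h by (simp add: epowr_ennreal powr_mult powr_powr)
qed

text \<open>Only \<open>t\<close> in \<open>(u, 1)\<close> is kept: there the inner norm is at least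
  \<open>u powr (1 / p) * rearr \<Omega> f u\<close>, and the weight integrates to
  \<open>(lg u powr b - 1) / b\<close>. This vanishes at \<open>u = 1\<close>, so \<open>u\<close>
  is kept away from 1.\<close>

lemma small_leb_norm_ge:
  assumes p: "1 < p"
  shows "\<exists>C>0. \<forall>f\<in>borel_measurable lebesgue. \<forall>u. 0 < u \<longrightarrow> u \<le> 1 / 2 \<longrightarrow>
    ennreal (phi_small p u * rearr \<Omega> f u) \<le> ennreal C * small_leb_norm \<Omega> p f"
proof -
  define b where "b = 1 - 1 / p"
  have b: "0 < b" using p by (simp add: b_def)
  \<comment> \<open>\<open>1 + ln 2\<close> is \<open>lg (1 / 2)\<close>, the least value of
    \<open>lg\<close> on \<open>(0, 1 / 2]\<close>. Hence \<open>c\<close> is a fraction of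
    \<open>lg u powr b\<close> that survives the subtraction of 1 on the whole interval.\<close>
  define c where "c = 1 - (1 + ln 2) powr (- b)"
  have "(1 + ln 2) powr (- b) < 1"
    using b by (simp add: powr_less_one)
  then have c: "0 < c" by (simp add: c_def)
  have "ennreal (phi_small p u * rearr \<Omega> f u) \<le> ennreal (b / c) * small_leb_norm \<Omega> p f"
    if f: "f \<in> borel_measurable lebesgue" and u: "0 < u" "u \<le> 1 / 2" for f u
  proof -
    define x where "x = u powr (1 / p) * rearr \<Omega> f u"
    have x: "0 \<le> x" using rearr_nonneg[OF \<Omega> f, of u] u by (simp add: x_def)
    have "1 + ln 2 = lg (1 / 2)" by (simp add: lg_def ln_div)
    also have "\<dots> \<le> lg u" using u by (intro lg_antimono) auto
    finally have l: "1 + ln 2 \<le> lg u" .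
    then have "(1 + ln 2) powr (- b) * lg u powr b \<ge> lg u powr (- b) * lg u powr b"
      using b by (intro mult_right_mono powr_mono2') (auto intro: add_pos_nonneg)
    moreover have "lg u powr (- b) * lg u powr b = 1"
      using u lg_ge_1[of u] by (simp add: powr_add[symmetric])
    ultimately have "c * lg u powr b \<le> lg u powr b - 1"
      by (simp add: c_def algebra_simps)
    then have "lg u powr b \<le> (lg u powr b - 1) / c"
      using c by (simp add: pos_le_divide_eq mult.commute)
    then have "lg u powr b * x \<le> (lg u powr b - 1) / c * x"
      using x by (rule mult_right_mono)
    then have "phi_small p u * rearr \<Omega> f u \<le> b / c * ((lg u powr b - 1) / b * x)"
      using b by (simp add: phi_small_def x_def b_def[symmetric] mult_ac)
    then have "ennreal (phi_small p u * rearr \<Omega> f u)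
        \<le> ennreal (b / c) * (ennreal ((lg u powr b - 1) / b) * ennreal x)"
      using b c x u lg_ge_1[of u] ge_one_powr_ge_zero[of "lg u" b]
      by (simp add: ennreal_mult[symmetric] ennreal_leI)
    also have "ennreal ((lg u powr b - 1) / b) * ennreal x
       = (\<integral>\<^sup>+ t. indicator {u<..<1} t * ennreal (lg t powr (- (1 / p)) / t) * ennreal x \<partial>lborel)"
      using nn_integral_lg_powr[of u "1 / p"] u p
      by (subst nn_integral_multc) (auto simp: b_def)
    also have "\<dots> \<le> small_leb_norm \<Omega> p f"
      unfolding small_leb_norm_def
    proof (rule nn_integral_mono)
      fix t :: real
      show "indicator {u<..<1} t * ennreal (lg t powr (- (1 / p)) / t) * ennreal x
        \<le> indicator {0<..<1} t * ennreal ((1 - ln t) powr (- 1 / p) / t) *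
        epowr (\<integral>\<^sup>+ s. indicator {0<..<t} s * ennreal (rearr \<Omega> f s powr p) \<partial>lborel) (1 / p)"
        using nn_integral_rearr_powr_ge[OF f, of p 0 u t] p u
        by (auto split: split_indicator simp: x_def lg_def intro!: mult_left_mono)
    qed
    finally show ?thesis by (simp add: mult_left_mono)
  qed
  then show ?thesis using b c by (intro exI[of _ "b / c"]) auto
qed

text \<open>A single point of the supremum suffices, \<open>t = u / 2\<close>, which is admissible
  for every \<open>u \<le> 1\<close>.\<close>

lemma grand_leb_norm_ge:
  assumes f: "f \<in> borel_measurable lebesgue" and q: "1 < q" and u: "0 < u" "u \<le> 1"
  shows "ennreal (phi_grand q u * rearr \<Omega> f u) \<le> ennreal 4 * grand_leb_norm \<Omega> q f"
proof -
  have h: "0 \<le> rearr \<Omega> f u" using rearr_nonneg[OF \<Omega> f, of u] u by simp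
  have "ennreal (phi_grand q u * rearr \<Omega> f u)
     \<le> ennreal (4 * (lg (u / 2) powr (- (1 / q)) * ((u - u / 2) powr (1 / q) * rearr \<Omega> f u)))"
    using mult_right_mono[OF phi_grand_half[OF q u] h] by (intro ennreal_leI) (simp add: mult_ac)
  also have "\<dots> = ennreal 4 * (ennreal (lg (u / 2) powr (- (1 / q)))
      * ennreal ((u - u / 2) powr (1 / q) * rearr \<Omega> f u))"
    using h by (simp add: ennreal_mult)
  also have "\<dots> \<le> ennreal 4 * (ennreal ((1 - ln (u / 2)) powr (- 1 / q))
      * epowr (\<integral>\<^sup>+ s. indicator {u / 2<..<1} s * ennreal (rearr \<Omega> f s powr q) \<partial>lborel) (1 / q))"
    using nn_integral_rearr_powr_ge[OF f, of q "u / 2" u 1] q u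
    by (auto simp: lg_def intro!: mult_left_mono)
  also have "\<dots> \<le> ennreal 4 * grand_leb_norm \<Omega> q f"
    unfolding grand_leb_norm_def using u by (intro mult_left_mono SUP_upper) auto
  finally show ?thesis .
qed

end

lemma nn_integral_powr_0:
  fixes s d :: real
  assumes "0 < s" "0 < d"
  shows "(\<integral>\<^sup>+ u. indicator {0<..<s} u * ennreal (u powr (d - 1)) \<partial>lborel) = ennreal (s powr d / d)"
proof -
  have "((\<lambda>u. u powr (d - 1)) has_integral (s powr (d - 1 + 1) / (d - 1 + 1))) {0..s}"
    using assms by (intro has_integral_powr_from_0) auto
  then have "(\<integral>\<^sup>+ u. ennreal (u powr (d - 1)) * indicator {0..s} u \<partial>lborel) = ennreal (s powr d / d)"
    by (subst nn_integral_has_integral_lebesgue') auto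
  moreover have "AE t in lborel. t \<noteq> 0 \<and> t \<noteq> s"
    by (intro AE_conjI AE_lborel_singleton)
  then have "(\<integral>\<^sup>+ u. indicator {0<..<s} u * ennreal (u powr (d - 1)) \<partial>lborel)
    = (\<integral>\<^sup>+ u. ennreal (u powr (d - 1)) * indicator {0..s} u \<partial>lborel)"
    by (intro nn_integral_cong_AE, elim eventually_mono) (auto split: split_indicator)
  ultimately show ?thesis by simp
qed

section \<open>Bounds for the K-functional\<close>

lemma phi_nonneg [simp]: "0 \<le> phi_small p u" "0 \<le> phi_grand p u"
  by (auto simp: phi_small_def phi_grand_def)

lemma phi_small_half_le:
  assumes p: "1 < p" and u: "0 < u" "u / 2 \<le> v" "v \<le> u" "u \<le> 1"
  shows "phi_small p u \<le> 2 * phi_small p v"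
proof -
  have "u powr (1 / p) \<le> (2 * v) powr (1 / p)" using p u by (intro powr_mono2) auto
  also have "\<dots> = 2 powr (1 / p) * v powr (1 / p)" using u by (simp add: powr_mult)
  also have "\<dots> \<le> 2 powr 1 * v powr (1 / p)" using p by (intro mult_right_mono powr_mono) auto
  finally have "u powr (1 / p) \<le> 2 * v powr (1 / p)" by simp
  moreover have "lg u powr (1 - 1 / p) \<le> lg v powr (1 - 1 / p)"
    using p u lg_antimono[of v u] lg_ge_1[of u] by (intro powr_mono2) auto
  ultimately have "phi_small p u \<le> (2 * v powr (1 / p)) * lg v powr (1 - 1 / p)"
    unfolding phi_small_def by (intro mult_mono) auto
  then show ?thesis by (simp add: phi_small_def)
qed

lemma K_fun_le_decomp:
  assumes "g0 \<in> borel_measurable lebesgue" "g1 \<in> borel_measurable lebesgue"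
    "\<And>x. x \<in> \<Omega> \<Longrightarrow> g x = g0 x + g1 x"
  shows "K_fun \<Omega> N0 N1 g t \<le> N0 g0 + ennreal t * N1 g1"
  unfolding K_fun_def by (rule INF_lower2[of "(g0, g1)"]) (use assms in auto)

text \<open>Dividing \<open>y\<close> by \<open>c\<close> turns the hypothesis into a lower bound
  for every member of the infimum; this avoids moving a factor through \<open>INF\<close> in the
  extended reals.\<close>

lemma le_mult_K_fun:
  assumes c: "0 < c"
    and le: "\<And>g0 g1. g0 \<in> borel_measurable lebesgue \<Longrightarrow> g1 \<in> borel_measurable lebesgue \<Longrightarrow>
      (\<And>x. x \<in> \<Omega> \<Longrightarrow> g x = g0 x + g1 x) \<Longrightarrow> y \<le> ennreal c * (N0 g0 + ennreal t * N1 g1)"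
  shows "y \<le> ennreal c * K_fun \<Omega> N0 N1 g t"
proof -
  have inv: "ennreal (1 / c) * (ennreal c * x) = x" "ennreal c * (ennreal (1 / c) * x) = x" for x
    using c by (auto simp: mult.assoc[symmetric] ennreal_mult[symmetric])
  have "ennreal (1 / c) * y \<le> N0 g0 + ennreal t * N1 g1"
    if "g0 \<in> borel_measurable lebesgue" "g1 \<in> borel_measurable lebesgue"
      "\<And>x. x \<in> \<Omega> \<Longrightarrow> g x = g0 x + g1 x" for g0 g1
    using mult_left_mono[OF le[OF that], of "ennreal (1 / c)"] by (simp add: inv)
  then have "ennreal (1 / c) * y \<le> K_fun \<Omega> N0 N1 g t"
    unfolding K_fun_def by (intro INF_greatest) auto
  then show ?thesis
    using mult_left_mono[of "ennreal (1 / c) * y" _ "ennreal c"] by (simp add: inv)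
qed

lemma K_fun_mono:
  assumes "s \<le> t"
  shows "K_fun \<Omega> N0 N1 g s \<le> K_fun \<Omega> N0 N1 g t"
  unfolding K_fun_def using assms
  by (intro INF_superset_mono order_refl add_left_mono mult_right_mono ennreal_leI) auto

text \<open>Together with \<open>K_fun_mono\<close> this allows the argument of the K-functional to
  be replaced by a comparable one, in particular \<rho> by \<open>sigma\<close>.\<close>

lemma K_fun_scale:
  assumes c: "1 \<le> c" and t: "0 \<le> t"
  shows "K_fun \<Omega> N0 N1 g (c * t) \<le> ennreal c * K_fun \<Omega> N0 N1 g t"
proof (rule le_mult_K_fun)
  fix g0 g1 :: "'a \<Rightarrow> real"
  assume "g0 \<in> borel_measurable lebesgue" "g1 \<in> borel_measurable lebesgue"
    "\<And>x. x \<in> \<Omega> \<Longrightarrow> g x = g0 x + g1 x"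
  then have "K_fun \<Omega> N0 N1 g (c * t) \<le> N0 g0 + ennreal (c * t) * N1 g1"
    by (rule K_fun_le_decomp)
  also have "\<dots> \<le> ennreal c * N0 g0 + ennreal (c * t) * N1 g1"
    using mult_right_mono[of 1 "ennreal c" "N0 g0"] c by (intro add_right_mono) simp
  also have "\<dots> = ennreal c * (N0 g0 + ennreal t * N1 g1)"
    using c t by (simp add: distrib_left ennreal_mult mult.assoc)
  finally show "K_fun \<Omega> N0 N1 g (c * t) \<le> ennreal c * (N0 g0 + ennreal t * N1 g1)" .
qed (use c in auto)

context
  fixes \<Omega> :: "'a::euclidean_space set"
  assumes \<Omega>: "\<Omega> \<in> sets lebesgue" "emeasure lebesgue \<Omega> < \<infinity>"
begin

text \<open>The arguments \<open>s / 2\<close> lie in \<open>(0, 1 / 2]\<close>, so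
  \<open>small_leb_norm_ge\<close> covers every \<open>s \<le> 1\<close>; doubling of the
  fundamental functions leads back to \<open>s\<close>. The balance between \<open>t\<close> and
  \<open>s\<close> turns the weight of the \<open>g1\<close> term into
  \<open>t * phi_grand q s\<close>.\<close>

lemma K_fun_ge:
  assumes p: "1 < p" and q: "1 < q"
  shows "\<exists>C>0. \<forall>g\<in>borel_measurable lebesgue. \<forall>s t. 0 < s \<longrightarrow> s \<le> 1 \<longrightarrow> t * phi_grand q s = phi_small p s \<longrightarrow>
    ennreal (phi_small p s * rearr \<Omega> g s)
      \<le> ennreal C * K_fun \<Omega> (small_leb_norm \<Omega> p) (grand_leb_norm \<Omega> q) g t"
proof -
  obtain C where C: "0 < C" and small: "\<And>f u. f \<in> borel_measurable lebesgue \<Longrightarrow> 0 < u \<Longrightarrow> u \<le> 1 / 2 \<Longrightarrow>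
      ennreal (phi_small p u * rearr \<Omega> f u) \<le> ennreal C * small_leb_norm \<Omega> p f"
    using small_leb_norm_ge[OF \<Omega> p] by blast
  \<comment> \<open>\<open>2 * C\<close> is the doubling constant of \<open>phi_small\<close> times
    the constant of the small norm; \<open>16 = 4 * 4\<close> is the same product for the grand
    norm.\<close>
  define D where "D = max (2 * C) 16"
  have D: "0 < D" "2 * C \<le> D" "16 \<le> D" by (auto simp: D_def)
  have "ennreal (phi_small p s * rearr \<Omega> g s)
      \<le> ennreal D * K_fun \<Omega> (small_leb_norm \<Omega> p) (grand_leb_norm \<Omega> q) g t"
    if g: "g \<in> borel_measurable lebesgue" and s: "0 < s" "s \<le> 1"
      and t: "t * phi_grand q s = phi_small p s" for g s t
  proof -
    have "0 < phi_grand q s" "0 < phi_small p s"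
      using s lg_ge_1[of s] by (auto simp: phi_grand_def phi_small_def)
    then have t0: "0 < t" using t by (metis zero_less_mult_pos2)
    have "ennreal (phi_small p s * rearr \<Omega> g s)
      \<le> ennreal D * (small_leb_norm \<Omega> p g0 + ennreal t * grand_leb_norm \<Omega> q g1)"
      if m: "g0 \<in> borel_measurable lebesgue" "g1 \<in> borel_measurable lebesgue"
        and eq: "\<And>x. x \<in> \<Omega> \<Longrightarrow> g x = g0 x + g1 x" for g0 g1
    proof -
      define h0 where "h0 = rearr \<Omega> g0 (s / 2)"
      define h1 where "h1 = rearr \<Omega> g1 (s / 2)"
      have h: "0 \<le> h0" "0 \<le> h1"
        using rearr_nonneg[OF \<Omega>, of _ "s / 2"] m s by (auto simp: h0_def h1_def)
      have "rearr \<Omega> g s \<le> h0 + h1"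
        using rearr_add_le[OF \<Omega> m g eq, of "s / 2" "s / 2"] s by (simp add: h0_def h1_def)
      then have "phi_small p s * rearr \<Omega> g s \<le> phi_small p s * h0 + t * (phi_grand q s * h1)"
        using mult_left_mono[of "rearr \<Omega> g s" "h0 + h1" "phi_small p s"] t
        by (simp add: distrib_left mult.assoc[symmetric])
      also have "\<dots> \<le> 2 * phi_small p (s / 2) * h0 + t * (4 * phi_grand q (s / 2) * h1)"
      proof -
        have "phi_grand q s \<le> 4 * phi_grand q (s / 2)"
          using phi_grand_half[OF q s] by (simp add: phi_grand_def)
        moreover have "phi_small p s \<le> 2 * phi_small p (s / 2)"
          using s by (intro phi_small_half_le[OF p]) auto
        ultimately show ?thesis using h t0
          by (intro add_mono mult_left_mono mult_right_mono) auto
      qed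
      finally have "ennreal (phi_small p s * rearr \<Omega> g s)
        \<le> ennreal (2 * (phi_small p (s / 2) * h0) + (t * 4) * (phi_grand q (s / 2) * h1))"
        by (intro ennreal_leI) (simp add: mult_ac)
      also have "\<dots> = ennreal 2 * ennreal (phi_small p (s / 2) * h0)
          + (ennreal t * ennreal 4) * ennreal (phi_grand q (s / 2) * h1)"
        using h t0 by (simp add: ennreal_plus ennreal_mult)
      also have "\<dots> \<le> ennreal 2 * (ennreal C * small_leb_norm \<Omega> p g0)
          + (ennreal t * ennreal 4) * (ennreal 4 * grand_leb_norm \<Omega> q g1)"
        unfolding h0_def h1_def
        using small[OF m(1), of "s / 2"] grand_leb_norm_ge[OF \<Omega> m(2) q, of "s / 2"] s
        by (intro add_mono mult_left_mono) auto
      also have "\<dots> = ennreal (2 * C) * small_leb_norm \<Omega> p g0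
          + ennreal 16 * (ennreal t * grand_leb_norm \<Omega> q g1)"
      proof -
        have "ennreal 16 = ennreal 4 * ennreal 4" by (subst ennreal_mult[symmetric]) auto
        moreover have "ennreal (2 * C) = ennreal 2 * ennreal C" using C by (intro ennreal_mult) auto
        ultimately show ?thesis by (simp only: mult_ac)
      qed
      also have "\<dots> \<le> ennreal D * small_leb_norm \<Omega> p g0 + ennreal D * (ennreal t * grand_leb_norm \<Omega> q g1)"
        using D by (intro add_mono mult_right_mono ennreal_leI) auto
      finally show ?thesis by (simp only: distrib_left)
    qed
    then show ?thesis using D(1) by (intro le_mult_K_fun) auto
  qed
  then show ?thesis using D(1) by blast
qed

text \<open>This absorbs the boundary term that the bounded part of the splitting produces at
  \<open>u = s\<close>. The integrand stays above half of
  \<open>phi_small p s * rearr \<Omega> g s / s\<close> on \<open>(s / 2, s)\<close>, an interval of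
  length \<open>s / 2\<close>; hence the factor 4.\<close>

lemma phi_small_rearr_le:
  assumes g: "g \<in> borel_measurable lebesgue" and p: "1 < p" and s: "0 < s" "s \<le> 1"
  shows "ennreal (phi_small p s * rearr \<Omega> g s)
    \<le> 4 * (\<integral>\<^sup>+ u. indicator {0<..<s} u * ennreal (phi_small p u * rearr \<Omega> g u / u) \<partial>lborel)"
proof -
  define c where "c = phi_small p s * rearr \<Omega> g s / (2 * s)"
  have c: "0 \<le> c" using s rearr_nonneg[OF \<Omega> g, of s] by (simp add: c_def)
  have [measurable]: "rearr \<Omega> g \<in> borel_measurable borel"
    by (rule borel_measurable_rearr[OF \<Omega> g])
  have "ennreal (phi_small p s * rearr \<Omega> g s) = ennreal (4 * (c * (s / 2)))"
    using s by (simp add: c_def)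
  also have "\<dots> = 4 * ennreal (c * (s / 2))"
    using s c by (subst ennreal_mult) auto
  also have "ennreal (c * (s / 2)) = (\<integral>\<^sup>+ u. indicator {s / 2<..<s} u * ennreal c \<partial>lborel)"
    using s c by (subst nn_integral_multc) (auto simp: ennreal_mult[symmetric] mult.commute)
  also have "\<dots> \<le> (\<integral>\<^sup>+ u. indicator {0<..<s} u * ennreal (phi_small p u * rearr \<Omega> g u / u) \<partial>lborel)"
  proof (rule nn_integral_mono)
    fix u :: real
    show "indicator {s / 2<..<s} u * ennreal c
      \<le> indicator {0<..<s} u * ennreal (phi_small p u * rearr \<Omega> g u / u)"
    proof (cases "u \<in> {s / 2<..<s}")
      case True
      have "phi_small p s / 2 \<le> phi_small p u"
        using phi_small_half_le[OF p s(1), of u] True s by simp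
      moreover have "rearr \<Omega> g s \<le> rearr \<Omega> g u" "0 \<le> rearr \<Omega> g s"
        using True s by (auto intro!: rearr_antimono[OF \<Omega> g] rearr_nonneg[OF \<Omega> g])
      ultimately have "phi_small p s / 2 * rearr \<Omega> g s / s \<le> phi_small p u * rearr \<Omega> g u / u"
        using True s by (intro frac_le mult_mono mult_nonneg_nonneg) auto
      then show ?thesis using True s by (auto simp: c_def intro!: ennreal_leI)
    qed simp
  qed
  finally show ?thesis by (simp add: mult_left_mono)
qed

text \<open>The unbounded part gives the first integral, since its rearrangement vanishes from
  \<open>s\<close> on. The bounded part gives the second and a boundary term
  \<open>t * phi_grand q s * h\<close>, controlled by \<open>phi_small_rearr_le\<close>. There the
  inequality between \<open>t * phi_grand q s\<close> and \<open>phi_small p s\<close> is enough, so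
  \<open>t = sigma s\<close> is admissible although it is only comparable with the quotient.\<close>

lemma K_fun_le:
  assumes p: "1 < p" and q: "1 < q"
  shows "\<exists>C>0. \<forall>g\<in>borel_measurable lebesgue. \<forall>s t. 0 < s \<longrightarrow> s < 1 \<longrightarrow> 0 \<le> t \<longrightarrow> t * phi_grand q s \<le> phi_small p s \<longrightarrow>
    K_fun \<Omega> (small_leb_norm \<Omega> p) (grand_leb_norm \<Omega> q) g t
     \<le> ennreal C * ((\<integral>\<^sup>+ u. indicator {0<..<s} u * ennreal (phi_small p u * rearr \<Omega> g u / u) \<partial>lborel)
      + ennreal t * (\<integral>\<^sup>+ u. indicator {s..<1} u * ennreal (phi_grand q u * rearr \<Omega> g u / u) \<partial>lborel))"
proof -
  define c where "c = 2 * p / (p - 1)"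
  \<comment> \<open>\<open>16 * q\<close> collects 4 from \<open>grand_leb_norm_le\<close>,
    \<open>q\<close> from integrating \<open>u powr (1 / q - 1)\<close> over \<open>(0, s)\<close>,
    and 4 from \<open>phi_small_rearr_le\<close>.\<close>
  define C where "C = c + 16 * q"
  have c: "0 < c" using p by (simp add: c_def)
  have C: "0 < C" "4 \<le> C" using c q by (auto simp: C_def)
  have "K_fun \<Omega> (small_leb_norm \<Omega> p) (grand_leb_norm \<Omega> q) g t
     \<le> ennreal C * ((\<integral>\<^sup>+ u. indicator {0<..<s} u * ennreal (phi_small p u * rearr \<Omega> g u / u) \<partial>lborel)
      + ennreal t * (\<integral>\<^sup>+ u. indicator {s..<1} u * ennreal (phi_grand q u * rearr \<Omega> g u / u) \<partial>lborel))"
    (is "_ \<le> _ * (?A + _ * ?B)")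
    if g: "g \<in> borel_measurable lebesgue" and s: "0 < s" "s < 1" and t: "0 \<le> t" "t * phi_grand q s \<le> phi_small p s"
    for g s t
  proof -
    have [measurable]: "rearr \<Omega> g \<in> borel_measurable borel"
      by (rule borel_measurable_rearr[OF \<Omega> g])
    define h where "h = rearr \<Omega> g s"
    have h: "0 \<le> h" using rearr_nonneg[OF \<Omega> g, of s] s by (simp add: h_def)
    define g0 where "g0 x = (if h < \<bar>g x\<bar> then g x else 0)" for x
    define g1 where "g1 x = (if h < \<bar>g x\<bar> then 0 else g x)" for x
    have m: "g0 \<in> borel_measurable lebesgue" "g1 \<in> borel_measurable lebesgue"
      using g unfolding g0_def[abs_def] g1_def[abs_def] by measurable
    have "small_leb_norm \<Omega> p g0 \<le> ennreal c *
        (\<integral>\<^sup>+ u. indicator {0<..<1} u * ennreal (phi_small p u * rearr \<Omega> g0 u / u) \<partial>lborel)"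
      unfolding c_def by (rule small_leb_norm_le[OF \<Omega> m(1) p])
    also have "\<dots> \<le> ennreal c * ?A"
    proof (intro mult_left_mono nn_integral_mono)
      fix u :: real
      have "rearr \<Omega> g0 u = 0" if "s \<le> u"
        using rearr_upper_part[OF \<Omega> g s(1) that] by (simp add: g0_def[abs_def] h_def)
      moreover have "rearr \<Omega> g0 u \<le> rearr \<Omega> g u" if "0 < u"
        using rearr_mono_fun[OF \<Omega> m(1) g] that by (auto simp: g0_def)
      ultimately show "indicator {0<..<1} u * ennreal (phi_small p u * rearr \<Omega> g0 u / u)
        \<le> indicator {0<..<s} u * ennreal (phi_small p u * rearr \<Omega> g u / u)"
        by (auto split: split_indicator intro!: ennreal_leI divide_right_mono mult_left_mono)
    qed simp
    finally have 1: "small_leb_norm \<Omega> p g0 \<le> ennreal c * ?A" .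
    have "grand_leb_norm \<Omega> q g1 \<le> ennreal 4 *
        (\<integral>\<^sup>+ u. indicator {0<..<1} u * ennreal (phi_grand q u * rearr \<Omega> g1 u / u) \<partial>lborel)"
      by (rule grand_leb_norm_le[OF \<Omega> m(2) q])
    \<comment> \<open>Below \<open>s\<close> the rearrangement of \<open>g1\<close> is at most
      \<open>h\<close>, and the increasing factor \<open>lg u powr (- (1 / q))\<close> is frozen at
      \<open>s\<close>, which leaves a pure power to integrate. From \<open>s\<close> on,
      \<open>g1\<close> is compared with \<open>g\<close>.\<close>
    also have "(\<integral>\<^sup>+ u. indicator {0<..<1} u * ennreal (phi_grand q u * rearr \<Omega> g1 u / u) \<partial>lborel)
      \<le> (\<integral>\<^sup>+ u. ennreal (lg s powr (- (1 / q)) * h) * (indicator {0<..<s} u * ennreal (u powr (1 / q - 1))) +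
          indicator {s..<1} u * ennreal (phi_grand q u * rearr \<Omega> g u / u) \<partial>lborel)"
    proof (rule nn_integral_mono)
      fix u :: real
      show "indicator {0<..<1} u * ennreal (phi_grand q u * rearr \<Omega> g1 u / u)
        \<le> ennreal (lg s powr (- (1 / q)) * h) * (indicator {0<..<s} u * ennreal (u powr (1 / q - 1))) +
          indicator {s..<1} u * ennreal (phi_grand q u * rearr \<Omega> g u / u)"
      proof (cases "0 < u \<and> u < s")
        case True
        have "rearr \<Omega> g1 u \<le> h"
          using rearr_lower_part[OF \<Omega> h, of g u] by (simp add: g1_def[abs_def])
        moreover have "lg u powr (- (1 / q)) \<le> lg s powr (- (1 / q))"
          using True s q lg_antimono[of u s] lg_ge_1[of s] by (intro powr_mono2') auto
        ultimately have "u powr (1 / q - 1) * (lg u powr (- (1 / q)) * rearr \<Omega> g1 u)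
            \<le> u powr (1 / q - 1) * (lg s powr (- (1 / q)) * h)"
          using rearr_nonneg[OF \<Omega> m(2), of u] True by (intro mult_left_mono mult_mono) auto
        moreover have "phi_grand q u * rearr \<Omega> g1 u / u
            = u powr (1 / q - 1) * (lg u powr (- (1 / q)) * rearr \<Omega> g1 u)"
          using True by (simp add: phi_grand_def powr_diff)
        ultimately have "ennreal (phi_grand q u * rearr \<Omega> g1 u / u)
            \<le> ennreal (lg s powr (- (1 / q)) * h) * ennreal (u powr (1 / q - 1))"
          using h by (subst ennreal_mult[symmetric]) (auto intro!: ennreal_leI simp: mult.commute)
        then show ?thesis using True s by simp
      next
        case False
        moreover have "rearr \<Omega> g1 u \<le> rearr \<Omega> g u" if "0 < u"
          using rearr_mono_fun[OF \<Omega> m(2) g] that by (auto simp: g1_def)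
        ultimately show ?thesis
          by (auto split: split_indicator intro!: ennreal_leI divide_right_mono mult_left_mono)
      qed
    qed
    also have "\<dots> = ennreal (lg s powr (- (1 / q)) * h) * ennreal (s powr (1 / q) / (1 / q)) + ?B"
      using s q by (subst nn_integral_add) (auto simp: nn_integral_cmult nn_integral_powr_0)
    also have "ennreal (lg s powr (- (1 / q)) * h) * ennreal (s powr (1 / q) / (1 / q))
        = ennreal (q * (phi_grand q s * h))"
      using q h by (subst ennreal_mult[symmetric]) (auto simp: phi_grand_def mult_ac)
    finally have "grand_leb_norm \<Omega> q g1 \<le> ennreal 4 * (ennreal (q * (phi_grand q s * h)) + ?B)"
      by (simp add: mult_left_mono)
    then have "ennreal t * grand_leb_norm \<Omega> q g1
        \<le> ennreal t * (ennreal 4 * (ennreal (q * (phi_grand q s * h)) + ?B))"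
      by (rule mult_left_mono) simp
    also have "\<dots> = ennreal 4 * (ennreal q * (ennreal (t * phi_grand q s * h))) + ennreal 4 * (ennreal t * ?B)"
      using t q h by (simp add: distrib_left ennreal_mult mult_ac)
    also have "\<dots> \<le> ennreal 4 * (ennreal q * (4 * ?A)) + ennreal C * (ennreal t * ?B)"
    proof -
      have "ennreal (t * phi_grand q s * h) \<le> ennreal (phi_small p s * h)"
        using t h by (intro ennreal_leI mult_right_mono) auto
      also have "\<dots> \<le> 4 * ?A"
        unfolding h_def using s by (intro phi_small_rearr_le[OF g p]) auto
      finally show ?thesis
        using C by (intro add_mono mult_left_mono mult_right_mono) auto
    qed
    also have "ennreal 4 * (ennreal q * (4 * ?A)) = ennreal (16 * q) * ?A"
    proof -
      have "ennreal (16 * q) = ennreal 4 * (ennreal q * ennreal 4)"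
        using q by (simp add: ennreal_mult[symmetric] del: ennreal_numeral)
      then show ?thesis by (simp add: mult_ac)
    qed
    finally have 2: "ennreal t * grand_leb_norm \<Omega> q g1 \<le> ennreal (16 * q) * ?A + ennreal C * (ennreal t * ?B)" .
    have "K_fun \<Omega> (small_leb_norm \<Omega> p) (grand_leb_norm \<Omega> q) g t
        \<le> small_leb_norm \<Omega> p g0 + ennreal t * grand_leb_norm \<Omega> q g1"
      by (rule K_fun_le_decomp[OF m]) (auto simp: g0_def g1_def)
    also have "\<dots> \<le> ennreal c * ?A + (ennreal (16 * q) * ?A + ennreal C * (ennreal t * ?B))"
      by (intro add_mono 1 2)
    also have "\<dots> = ennreal C * (?A + ennreal t * ?B)"
      using c q by (simp add: C_def ennreal_plus distrib_left distrib_right add_ac)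
    finally show ?thesis .
  qed
  then show ?thesis using C(1) by blast
qed

end

section \<open>Schur test and change of variables\<close>

text \<open>For positive arguments this is \<open>min (u / s) (s / u) powr \<delta>\<close>,
  symmetric and homogeneous of degree 0, hence adapted to the measure \<open>du / u\<close>.\<close>

definition hardy_ker :: "real \<Rightarrow> real \<Rightarrow> real \<Rightarrow> real" where
  "hardy_ker \<delta> s u = (if u \<le> s then (u / s) powr \<delta> else (s / u) powr \<delta>)"

lemma hardy_ker_commute: "hardy_ker \<delta> s u = hardy_ker \<delta> u s"
  by (cases "s = u") (auto simp: hardy_ker_def)

lemma hardy_ker_nonneg [simp]: "0 \<le> hardy_ker \<delta> s u"
  by (simp add: hardy_ker_def)

lemma measurable_hardy_ker [measurable]:
  assumes [measurable]: "f \<in> borel_measurable M" "g \<in> borel_measurable M"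
  shows "(\<lambda>x. hardy_ker \<delta> (f x) (g x)) \<in> borel_measurable M"
  unfolding hardy_ker_def by measurable

text \<open>Each side of \<open>s\<close> contributes at most \<open>1 / \<delta>\<close>, uniformly
  in \<open>s\<close>.\<close>

lemma nn_integral_hardy_ker:
  assumes s: "0 < s" "s < 1" and d: "0 < \<delta>"
  shows "(\<integral>\<^sup>+ u. indicator {0<..<1} u * ennreal (hardy_ker \<delta> s u / u) \<partial>lborel) \<le> ennreal (2 / \<delta>)"
proof -
  have "(\<integral>\<^sup>+ u. indicator {0<..<1} u * ennreal (hardy_ker \<delta> s u / u) \<partial>lborel)
     \<le> (\<integral>\<^sup>+ u. ennreal (s powr (- \<delta>)) * (indicator {0<..<s} u * ennreal (u powr (\<delta> - 1)))
        + ennreal (s powr \<delta>) * (ennreal (u powr (- \<delta> - 1)) * indicator {s..1} u) \<partial>lborel)"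
  proof (rule nn_integral_mono)
    fix u :: real
    consider "u \<le> 0 \<or> 1 \<le> u" | "0 < u" "u < s" | "s \<le> u" "u < 1" by linarith
    then show "indicator {0<..<1} u * ennreal (hardy_ker \<delta> s u / u)
      \<le> ennreal (s powr (- \<delta>)) * (indicator {0<..<s} u * ennreal (u powr (\<delta> - 1)))
        + ennreal (s powr \<delta>) * (ennreal (u powr (- \<delta> - 1)) * indicator {s..1} u)"
    proof cases
      case 2
      then have "hardy_ker \<delta> s u / u = s powr (- \<delta>) * u powr (\<delta> - 1)"
        using s by (simp add: hardy_ker_def powr_divide powr_minus powr_diff field_simps)
      then show ?thesis using 2 s by (simp add: ennreal_mult)
    next
      case 3
      then have "hardy_ker \<delta> s u / u = s powr \<delta> * u powr (- \<delta> - 1)"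
        using s by (auto simp: hardy_ker_def powr_divide powr_minus powr_diff field_simps)
      then show ?thesis using 3 s by (simp add: ennreal_mult)
    qed auto
  qed
  also have "\<dots> = ennreal (s powr (- \<delta>)) * ennreal (s powr \<delta> / \<delta>) + ennreal (s powr \<delta>) *
      (\<integral>\<^sup>+ u. ennreal (u powr (- \<delta> - 1)) * indicator {s..1} u \<partial>lborel)"
    using s d by (subst nn_integral_add) (auto simp: nn_integral_cmult nn_integral_powr_0)
  also have "(\<integral>\<^sup>+ u. ennreal (u powr (- \<delta> - 1)) * indicator {s..1} u \<partial>lborel)
      = ennreal (- (1 powr (- \<delta>) / \<delta>) - (- (s powr (- \<delta>) / \<delta>)))"
  proof (rule nn_integral_FTC_Icc)
    fix u assume "u \<in> {s..1}"
    then show "((\<lambda>u. - (u powr (- \<delta>) / \<delta>)) has_real_derivative u powr (- \<delta> - 1)) (at u)"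
      using s d by (auto intro!: derivative_eq_intros simp: powr_diff)
  qed (use s in auto)
  also have "\<dots> \<le> ennreal (s powr (- \<delta>) / \<delta>)"
    using d by (intro ennreal_leI) auto
  finally have "(\<integral>\<^sup>+ u. indicator {0<..<1} u * ennreal (hardy_ker \<delta> s u / u) \<partial>lborel)
    \<le> ennreal (s powr (- \<delta>)) * ennreal (s powr \<delta> / \<delta>) + ennreal (s powr \<delta>) * ennreal (s powr (- \<delta>) / \<delta>)"
    by (meson add_left_mono mult_left_mono zero_le)
  also have "\<dots> = ennreal (2 / \<delta>)"
  proof -
    have "s powr (- \<delta>) * s powr \<delta> = 1" using s by (simp add: powr_add[symmetric])
    then show ?thesis using d s
      by (simp add: ennreal_mult[symmetric] ennreal_plus[symmetric] mult.commute del: ennreal_plus)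
  qed
  finally show ?thesis .
qed

text \<open>Schur test: Jensen in \<open>u\<close> costs \<open>(2 / \<delta>) powr (r - 1)\<close>,
  and after Tonelli the symmetry of the kernel makes the integral in \<open>s\<close> cost one more
  factor \<open>2 / \<delta>\<close>.\<close>

lemma nn_integral_hardy_ker_powr_le:
  assumes [measurable]: "G \<in> borel_measurable borel" and d: "0 < \<delta>" and r: "1 \<le> r"
  shows "(\<integral>\<^sup>+ s. indicator {0<..<1} s * epowr (\<integral>\<^sup>+ u. indicator {0<..<1} u * ennreal (hardy_ker \<delta> s u / u) * G u \<partial>lborel) r
        * ennreal (1 / s) \<partial>lborel)
    \<le> ennreal ((2 / \<delta>) powr r) * (\<integral>\<^sup>+ u. indicator {0<..<1} u * epowr (G u) r * ennreal (1 / u) \<partial>lborel)"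
proof -
  define B where "B = (2 / \<delta>) powr (r - 1)"
  have "(\<integral>\<^sup>+ s. indicator {0<..<1} s * epowr (\<integral>\<^sup>+ u. indicator {0<..<1} u * ennreal (hardy_ker \<delta> s u / u) * G u \<partial>lborel) r
        * ennreal (1 / s) \<partial>lborel)
     \<le> (\<integral>\<^sup>+ s. ennreal B * (\<integral>\<^sup>+ u. indicator {0<..<1} s * ennreal (1 / s) *
          (indicator {0<..<1} u * ennreal (hardy_ker \<delta> s u / u) * epowr (G u) r) \<partial>lborel) \<partial>lborel)"
  proof (rule nn_integral_mono)
    fix s :: real
    show "indicator {0<..<1} s * epowr (\<integral>\<^sup>+ u. indicator {0<..<1} u * ennreal (hardy_ker \<delta> s u / u) * G u \<partial>lborel) r
        * ennreal (1 / s) \<le> ennreal B * (\<integral>\<^sup>+ u. indicator {0<..<1} s * ennreal (1 / s) *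
          (indicator {0<..<1} u * ennreal (hardy_ker \<delta> s u / u) * epowr (G u) r) \<partial>lborel)"
    proof (cases "s \<in> {0<..<1}")
      case True
      have "epowr (\<integral>\<^sup>+ u. indicator {0<..<1} u * ennreal (hardy_ker \<delta> s u / u) * G u \<partial>lborel) r
          \<le> ennreal B * (\<integral>\<^sup>+ u. indicator {0<..<1} u * ennreal (hardy_ker \<delta> s u / u) * epowr (G u) r \<partial>lborel)"
        unfolding B_def using True d r nn_integral_hardy_ker[of s \<delta>]
        by (intro nn_integral_jensen_epowr) auto
      from mult_right_mono[OF this, of "ennreal (1 / s)"] True show ?thesis
        by (subst nn_integral_cmult) (auto simp: mult_ac)
    qed simp
  qed
  also have "\<dots> = ennreal B * (\<integral>\<^sup>+ s. (\<integral>\<^sup>+ u. indicator {0<..<1} s * ennreal (1 / s) *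
          (indicator {0<..<1} u * ennreal (hardy_ker \<delta> s u / u) * epowr (G u) r) \<partial>lborel) \<partial>lborel)"
    by (rule nn_integral_cmult) measurable
  also have "(\<integral>\<^sup>+ s. (\<integral>\<^sup>+ u. indicator {0<..<1} s * ennreal (1 / s) *
          (indicator {0<..<1} u * ennreal (hardy_ker \<delta> s u / u) * epowr (G u) r) \<partial>lborel) \<partial>lborel)
     = (\<integral>\<^sup>+ u. (\<integral>\<^sup>+ s. indicator {0<..<1} s * ennreal (1 / s) *
          (indicator {0<..<1} u * ennreal (hardy_ker \<delta> s u / u) * epowr (G u) r) \<partial>lborel) \<partial>lborel)"
    by (rule lborel_pair.Fubini'[symmetric]) measurable
  also have "\<dots> \<le> (\<integral>\<^sup>+ u. ennreal (2 / \<delta>) * (indicator {0<..<1} u * epowr (G u) r * ennreal (1 / u)) \<partial>lborel)"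
  proof (rule nn_integral_mono)
    fix u :: real
    show "(\<integral>\<^sup>+ s. indicator {0<..<1} s * ennreal (1 / s) *
          (indicator {0<..<1} u * ennreal (hardy_ker \<delta> s u / u) * epowr (G u) r) \<partial>lborel)
        \<le> ennreal (2 / \<delta>) * (indicator {0<..<1} u * epowr (G u) r * ennreal (1 / u))"
    proof (cases "u \<in> {0<..<1}")
      case True
      have "indicator {0<..<1} s * ennreal (1 / s) * (indicator {0<..<1} u * ennreal (hardy_ker \<delta> s u / u) * epowr (G u) r)
         = indicator {0<..<1} s * ennreal (hardy_ker \<delta> u s / s) * (epowr (G u) r * ennreal (1 / u))" for s
      proof (cases "s \<in> {0<..<1}")
        case s: True
        have "ennreal (1 / s) * ennreal (hardy_ker \<delta> s u / u) = ennreal (hardy_ker \<delta> u s / s) * ennreal (1 / u)"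
          using s True by (simp add: ennreal_mult[symmetric] hardy_ker_commute[of \<delta> s u])
        then show ?thesis using s True by (simp add: mult.assoc[symmetric]) (simp add: mult_ac)
      qed simp
      then have "(\<integral>\<^sup>+ s. indicator {0<..<1} s * ennreal (1 / s) *
          (indicator {0<..<1} u * ennreal (hardy_ker \<delta> s u / u) * epowr (G u) r) \<partial>lborel)
         = (\<integral>\<^sup>+ s. indicator {0<..<1} s * ennreal (hardy_ker \<delta> u s / s) \<partial>lborel) * (epowr (G u) r * ennreal (1 / u))"
        by (simp add: nn_integral_multc)
      also have "\<dots> \<le> ennreal (2 / \<delta>) * (epowr (G u) r * ennreal (1 / u))"
        using True d nn_integral_hardy_ker[of u \<delta>] by (intro mult_right_mono) auto
      finally show ?thesis using True by simp
    qed simp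
  qed
  also have "\<dots> = ennreal (2 / \<delta>) * (\<integral>\<^sup>+ u. indicator {0<..<1} u * epowr (G u) r * ennreal (1 / u) \<partial>lborel)"
    by (rule nn_integral_cmult) measurable
  finally have "(\<integral>\<^sup>+ s. indicator {0<..<1} s * epowr (\<integral>\<^sup>+ u. indicator {0<..<1} u * ennreal (hardy_ker \<delta> s u / u) * G u \<partial>lborel) r
        * ennreal (1 / s) \<partial>lborel)
      \<le> ennreal B * (ennreal (2 / \<delta>) * (\<integral>\<^sup>+ u. indicator {0<..<1} u * epowr (G u) r * ennreal (1 / u) \<partial>lborel))"
    by (simp add: mult_left_mono)
  also have "\<dots> = ennreal ((2 / \<delta>) powr r) * (\<integral>\<^sup>+ u. indicator {0<..<1} u * epowr (G u) r * ennreal (1 / u) \<partial>lborel)"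
    using d by (simp add: B_def mult.assoc[symmetric] ennreal_mult[symmetric] powr_diff)
  finally show ?thesis .
qed

text \<open>The derivative is controlled only away from 0, so the substitution is made on
  \<open>[e n, 1]\<close> and the intervals exhaust \<open>(0, 1]\<close> by monotone convergence.
  That their images exhaust \<open>(0, 1]\<close> is the content of the limit at 0.\<close>

lemma nn_integral_substitution_unit_interval:
  fixes H :: "real \<Rightarrow> ennreal" and \<sigma> \<sigma>' :: "real \<Rightarrow> real"
  assumes [measurable]: "H \<in> borel_measurable borel" "\<sigma> \<in> borel_measurable borel" "\<sigma>' \<in> borel_measurable borel"
    and deriv: "\<And>s. 0 < s \<Longrightarrow> s \<le> 1 \<Longrightarrow> (\<sigma> has_real_derivative \<sigma>' s) (at s)"
    and cont: "continuous_on {0<..1} \<sigma>'"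
    and nonneg: "\<And>s. 0 < s \<Longrightarrow> s \<le> 1 \<Longrightarrow> 0 \<le> \<sigma>' s"
    and pos: "\<And>s. 0 < s \<Longrightarrow> s \<le> 1 \<Longrightarrow> 0 < \<sigma> s" and one: "\<sigma> 1 = 1"
    and lim: "(\<sigma> \<longlongrightarrow> 0) (at_right 0)"
  shows "(\<integral>\<^sup>+ t. indicator {0<..<1} t * H t \<partial>lborel)
     = (\<integral>\<^sup>+ s. indicator {0<..<1} s * (H (\<sigma> s) * ennreal (\<sigma>' s)) \<partial>lborel)"
proof -
  \<comment> \<open>The shift by 2 keeps \<open>e n < 1\<close> already at
    \<open>n = 0\<close>.\<close>
  define e where "e n = 1 / real (n + 2)" for n
  have e: "0 < e n" "e n < 1" for n by (auto simp: e_def)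
  have mono: "\<sigma> s \<le> \<sigma> t" if "0 < s" "s \<le> t" "t \<le> 1" for s t
    using that by (intro DERIV_nonneg_imp_nondecreasing[of s t \<sigma>]) (auto intro!: exI deriv nonneg)
  have dec: "e m \<le> e n" if "n \<le> m" for n m using that by (auto simp: e_def frac_le)
  have e0: "e \<longlonglongrightarrow> 0"
    unfolding e_def using LIMSEQ_ignore_initial_segment[OF lim_1_over_n, of 2] by simp
  have se0: "(\<lambda>n. \<sigma> (e n)) \<longlonglongrightarrow> 0"
    using lim e0 e by (rule_tac filterlim_compose[of \<sigma> _ "at_right 0"]) (auto simp: filterlim_at less_imp_neq[OF e(1), symmetric])
  have eq: "(\<integral>\<^sup>+ t. H t * indicator {\<sigma> (e n)..\<sigma> 1} t \<partial>lborel)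
      = (\<integral>\<^sup>+ s. H (\<sigma> s) * ennreal (\<sigma>' s) * indicator {e n..1} s \<partial>lborel)" for n
    using e[of n] by (intro nn_integral_substitution_aux)
      (auto intro!: deriv nonneg continuous_on_subset[OF cont])
  have "(\<integral>\<^sup>+ t. indicator {0<..<1} t * H t \<partial>lborel) = (\<integral>\<^sup>+ t. (SUP n. H t * indicator {\<sigma> (e n)..\<sigma> 1} t) \<partial>lborel)"
  proof (rule nn_integral_cong_AE)
    show "AE t in lborel. indicator {0<..<1} t * H t = (SUP n. H t * indicator {\<sigma> (e n)..\<sigma> 1} t)"
      using AE_lborel_singleton[of 1]
    proof eventually_elim
      fix t :: real assume t: "t \<noteq> 1"
      show "indicator {0<..<1} t * H t = (SUP n. H t * indicator {\<sigma> (e n)..\<sigma> 1} t)"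
      proof (cases "0 < t \<and> t < 1")
        case True
        then have "eventually (\<lambda>n. \<sigma> (e n) < t) sequentially"
          using se0 by (intro order_tendstoD(2)) auto
        then obtain n where "\<sigma> (e n) < t" by (auto simp: eventually_sequentially)
        then have "H t \<le> (SUP n. H t * indicator {\<sigma> (e n)..\<sigma> 1} t)"
          using True one by (intro SUP_upper2[of n]) auto
        moreover have "(SUP n. H t * indicator {\<sigma> (e n)..\<sigma> 1} t) \<le> H t"
          by (intro SUP_least) (auto split: split_indicator)
        ultimately show ?thesis using True by simp
      next
        case False
        then have "t \<notin> {\<sigma> (e n)..\<sigma> 1}" for n using t one pos[of "e n"] e[of n] by auto
        then show ?thesis using False by simp
      qed
    qed
  qed
  also have "\<dots> = (SUP n. (\<integral>\<^sup>+ t. H t * indicator {\<sigma> (e n)..\<sigma> 1} t \<partial>lborel))"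
  proof (rule nn_integral_monotone_convergence_SUP)
    show "incseq (\<lambda>n t. H t * indicator {\<sigma> (e n)..\<sigma> 1} t)"
      using mono[OF e(1) dec] e by (force simp: incseq_def le_fun_def less_imp_le split: split_indicator)
  qed measurable
  also have "\<dots> = (SUP n. (\<integral>\<^sup>+ s. H (\<sigma> s) * ennreal (\<sigma>' s) * indicator {e n..1} s \<partial>lborel))"
    by (simp only: eq)
  also have "\<dots> = (\<integral>\<^sup>+ s. (SUP n. H (\<sigma> s) * ennreal (\<sigma>' s) * indicator {e n..1} s) \<partial>lborel)"
  proof (rule nn_integral_monotone_convergence_SUP[symmetric])
    show "incseq (\<lambda>n s. H (\<sigma> s) * ennreal (\<sigma>' s) * indicator {e n..1} s)"
      using dec by (force simp: incseq_def le_fun_def split: split_indicator)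
  qed measurable
  also have "\<dots> = (\<integral>\<^sup>+ s. indicator {0<..<1} s * (H (\<sigma> s) * ennreal (\<sigma>' s)) \<partial>lborel)"
  proof (rule nn_integral_cong_AE)
    show "AE s in lborel. (SUP n. H (\<sigma> s) * ennreal (\<sigma>' s) * indicator {e n..1} s)
        = indicator {0<..<1} s * (H (\<sigma> s) * ennreal (\<sigma>' s))"
      using AE_lborel_singleton[of 1]
    proof eventually_elim
      fix s :: real assume s: "s \<noteq> 1"
      show "(SUP n. H (\<sigma> s) * ennreal (\<sigma>' s) * indicator {e n..1} s)
        = indicator {0<..<1} s * (H (\<sigma> s) * ennreal (\<sigma>' s))"
      proof (cases "0 < s \<and> s < 1")
        case True
        then have "eventually (\<lambda>n. e n < s) sequentially"
          using e0 by (intro order_tendstoD(2)) auto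
        then obtain n where "e n < s" by (auto simp: eventually_sequentially)
        then have "H (\<sigma> s) * ennreal (\<sigma>' s) \<le> (SUP n. H (\<sigma> s) * ennreal (\<sigma>' s) * indicator {e n..1} s)"
          using True by (intro SUP_upper2[of n]) auto
        moreover have "(SUP n. H (\<sigma> s) * ennreal (\<sigma>' s) * indicator {e n..1} s) \<le> H (\<sigma> s) * ennreal (\<sigma>' s)"
          by (intro SUP_least) (auto split: split_indicator)
        ultimately show ?thesis using True by simp
      next
        case False
        then have "s \<notin> {e n..1}" for n using s e[of n] by auto
        then show ?thesis using False by simp
      qed
    qed
  qed
  finally show ?thesis .
qed

section \<open>The comparison function\<close>

text \<open>
  Taking \<open>c\<close> large makes the logarithmic derivative \<open>(a - b / (c - ln s)) / s\<close> positive up to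
  \<open>s = 1\<close>.
\<close>

definition lgpow :: "real \<Rightarrow> real \<Rightarrow> real \<Rightarrow> real \<Rightarrow> real" where
  "lgpow c a b s = s powr a * (1 - ln s / c) powr b"

lemma measurable_lgpow [measurable]: "lgpow c a b \<in> borel_measurable borel"
  unfolding lgpow_def[abs_def] by measurable

lemma lgpow_base_ge_1:
  assumes "1 \<le> c" "0 < s" "s \<le> 1"
  shows "1 \<le> 1 - ln s / (c::real)"
  using assms by (simp add: divide_le_0_iff)

lemma lgpow_pos:
  assumes "1 \<le> c" "0 < s" "s \<le> 1"
  shows "0 < lgpow c a b s"
proof -
  have "1 - ln s / c \<noteq> 0" using lgpow_base_ge_1[OF assms] by linarith
  then show ?thesis using assms by (simp add: lgpow_def zero_less_mult_iff)
qed

lemma DERIV_lgpow: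
  assumes "1 \<le> c" "0 < s" "s \<le> 1"
  shows "(lgpow c a b has_real_derivative lgpow c a b s / s * (a - b / (c - ln s))) (at s)"
proof -
  have g: "1 \<le> 1 - ln s / c" by (rule lgpow_base_ge_1[OF assms])
  have "((\<lambda>s. 1 - ln s / c) has_real_derivative - (1 / (s * c))) (at s)"
    using assms by (auto intro!: derivative_eq_intros)
  then have 1: "((\<lambda>s. (1 - ln s / c) powr b) has_real_derivative
      b * (1 - ln s / c) powr (b - of_nat 1) * - (1 / (s * c))) (at s)"
    using g by (intro DERIV_fun_powr) auto
  have 2: "((\<lambda>s. s powr a) has_real_derivative a * s powr (a - 1)) (at s)"
    using assms by (auto intro!: derivative_eq_intros)
  have "a * s powr (a - 1) * (1 - ln s / c) powr b
      + b * (1 - ln s / c) powr (b - of_nat 1) * - (1 / (s * c)) * s powr a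
      = lgpow c a b s / s * (a - b / (c - ln s))"
  proof -
    define y where "y = 1 - ln s / c"
    have y: "0 < y" unfolding y_def using g by linarith
    have cy: "c - ln s = c * y" using assms by (simp add: y_def right_diff_distrib)
    show ?thesis
      unfolding lgpow_def y_def[symmetric] cy using assms y by (simp add: powr_diff field_simps)
  qed
  with DERIV_mult[OF 2 1] show ?thesis
    unfolding lgpow_def[abs_def] by simp
qed

text \<open>The hypothesis on \<open>d\<close> leaves enough of the exponent: with
  \<open>a - d\<close> in place of \<open>a\<close> the function is still nondecreasing up to 1, and
  the split-off power gives the bound.\<close>

lemma lgpow_ratio_le:
  assumes c: "1 \<le> c" and b: "0 \<le> b" and d: "b \<le> (a - d) * c" and us: "0 < u" "u \<le> s" "s \<le> 1"
  shows "lgpow c a b u / lgpow c a b s \<le> (u / s) powr d"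
proof -
  have "lgpow c (a - d) b u \<le> lgpow c (a - d) b s"
  proof (rule DERIV_nonneg_imp_nondecreasing[OF us(2)])
    fix x assume "u \<le> x" "x \<le> s"
    then have x: "0 < x" "x \<le> 1" using us by auto
    then have l: "c \<le> c - ln x" by simp
    have "0 \<le> (a - d) * c" using b d by simp
    then have "0 \<le> a - d" using c by (simp add: zero_le_mult_iff)
    then have "b \<le> (a - d) * (c - ln x)" using l d by (meson mult_left_mono order_trans)
    then have "0 \<le> a - d - b / (c - ln x)" using l c by (simp add: divide_le_eq)
    moreover have "0 \<le> lgpow c (a - d) b x / x" using lgpow_pos[OF c x] x by (simp add: less_imp_le)
    ultimately show "\<exists>y. (lgpow c (a - d) b has_real_derivative y) (at x) \<and> 0 \<le> y"
      using DERIV_lgpow[OF c x] by (meson mult_nonneg_nonneg)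
  qed
  moreover have "lgpow c (a - d) b x = lgpow c a b x / x powr d" for x
    by (simp add: lgpow_def powr_diff)
  ultimately show ?thesis
    using us lgpow_pos[OF c, of s a b] by (simp add: powr_divide field_simps)
qed

context
  fixes a c :: real
  assumes a: "0 < a" "a < 1" and c: "1 \<le> c" "2 * (1 - a) \<le> a * c"
begin

text \<open>For \<open>a = 1 / p - 1 / q\<close> the quotient of the fundamental functions is
  \<open>s powr a * lg s powr (1 - a)\<close>, whence the exponent \<open>1 - a\<close>. The
  condition \<open>2 * (1 - a) \<le> a * c\<close> reserves half of \<open>a\<close> against the
  logarithm, which is the source of every \<open>a / 2\<close> below.\<close>

definition sigma :: "real \<Rightarrow> real" where "sigma = lgpow c a (1 - a)"

definition sigma_deriv :: "real \<Rightarrow> real" where "sigma_deriv s = sigma s / s * (a - (1 - a) / (c - ln s))"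

lemma sigma_pos: "0 < s \<Longrightarrow> s \<le> 1 \<Longrightarrow> 0 < sigma s"
  unfolding sigma_def using c by (intro lgpow_pos)

lemma measurable_sigma [measurable]: "sigma \<in> borel_measurable borel"
  unfolding sigma_def by measurable

lemma measurable_sigma_deriv [measurable]: "sigma_deriv \<in> borel_measurable borel"
  unfolding sigma_deriv_def[abs_def] by measurable

text \<open>Under \<open>t = sigma s\<close> the measure \<open>dt / t\<close> becomes comparable
  with \<open>ds / s\<close>.\<close>

lemma sigma_deriv_bounds:
  assumes s: "0 < s" "s \<le> 1"
  shows "a / 2 * (1 / s) \<le> sigma_deriv s / sigma s" "sigma_deriv s / sigma s \<le> a * (1 / s)"
proof -
  have eq: "sigma_deriv s / sigma s = (a - (1 - a) / (c - ln s)) * (1 / s)"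
    using sigma_pos[OF s] by (simp add: sigma_deriv_def)
  have l: "c \<le> c - ln s" using s by simp
  have "(1 - a) / (c - ln s) \<le> (1 - a) / c" using l a c by (intro divide_left_mono) auto
  also have "\<dots> \<le> a / 2" using a c by (simp add: field_simps)
  finally have "a / 2 \<le> a - (1 - a) / (c - ln s)" by simp
  then show "a / 2 * (1 / s) \<le> sigma_deriv s / sigma s"
    unfolding eq using s by (intro mult_right_mono) auto
  have "a - (1 - a) / (c - ln s) \<le> a" using l a c by simp
  then show "sigma_deriv s / sigma s \<le> a * (1 / s)"
    unfolding eq using s by (intro mult_right_mono) auto
qed

lemma sigma_ratio_le:
  assumes "0 < u" "u \<le> s" "s \<le> 1"
  shows "sigma u / sigma s \<le> (u / s) powr (a / 2)"
  unfolding sigma_def using a c assms by (intro lgpow_ratio_le) (auto simp: algebra_simps)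

text \<open>Used with \<open>e = \<theta>\<close> on one side of \<open>s\<close> and
  \<open>e = 1 - \<theta>\<close> on the other, with a common \<open>\<delta>\<close>, to produce
  the Hardy kernel.\<close>

lemma sigma_ratio_powr_le:
  assumes "0 < u" "u \<le> s" "s \<le> 1" "0 \<le> e" "\<delta> \<le> e * (a / 2)"
  shows "(sigma u / sigma s) powr e \<le> (u / s) powr \<delta>"
proof -
  have "(sigma u / sigma s) powr e \<le> ((u / s) powr (a / 2)) powr e"
    using assms sigma_ratio_le[of u s] sigma_pos[of u] sigma_pos[of s] by (intro powr_mono2) auto
  also have "\<dots> = (u / s) powr (e * (a / 2))" by (simp add: powr_powr mult.commute)
  also have "\<dots> \<le> (u / s) powr \<delta>" using assms by (intro powr_mono') auto
  finally show ?thesis .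
qed

lemma nn_integral_sigma_substitution:
  fixes H :: "real \<Rightarrow> ennreal"
  assumes [measurable]: "H \<in> borel_measurable borel"
  shows "(\<integral>\<^sup>+ t. indicator {0<..<1} t * H t \<partial>lborel)
     = (\<integral>\<^sup>+ s. indicator {0<..<1} s * (H (sigma s) * ennreal (sigma_deriv s)) \<partial>lborel)"
proof (rule nn_integral_substitution_unit_interval)
  show "(sigma has_real_derivative sigma_deriv s) (at s)" if "0 < s" "s \<le> 1" for s
    unfolding sigma_deriv_def sigma_def using c that by (intro DERIV_lgpow)
  show "0 \<le> sigma_deriv s" if s: "0 < s" "s \<le> 1" for s
  proof -
    have "0 \<le> a / 2 * (1 / s)" using a s by simp
    then have "0 \<le> sigma_deriv s / sigma s" using sigma_deriv_bounds(1)[OF s] by linarith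
    then show ?thesis using sigma_pos[OF s] by (simp add: zero_le_divide_iff)
  qed
  show "continuous_on {0<..1} sigma_deriv"
  proof -
    have "1 - ln s / c \<noteq> 0" if "0 < s" "s \<le> 1" for s
      using lgpow_base_ge_1[OF c(1) that] by linarith
    moreover have "c - ln s \<noteq> 0" if "0 < s" "s \<le> 1" for s
    proof -
      have "ln s \<le> 0" using that by simp
      then show ?thesis using c by linarith
    qed
    ultimately show ?thesis
      unfolding sigma_deriv_def[abs_def] sigma_def lgpow_def using c
      by (intro continuous_intros) auto
  qed
  show "sigma 1 = 1" by (simp add: sigma_def lgpow_def)
  show "(sigma \<longlongrightarrow> 0) (at_right 0)"
  proof (rule tendsto_sandwich)
    have ev: "eventually (\<lambda>s::real. 0 < s \<and> s < 1) (at_right 0)"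
      by (auto simp: eventually_at_right[of 0 1] intro!: exI[of _ 1])
    then show "eventually (\<lambda>s. 0 \<le> sigma s) (at_right 0)"
      by eventually_elim (auto intro!: less_imp_le[OF sigma_pos])
    show "eventually (\<lambda>s. sigma s \<le> s powr (a / 2)) (at_right 0)"
      using ev
    proof eventually_elim
      case (elim s)
      then show ?case using sigma_ratio_le[of s 1] \<open>sigma 1 = 1\<close> by simp
    qed
    have "((\<lambda>s. s powr (a / 2)) \<longlongrightarrow> 0 powr (a / 2)) (at_right 0)"
      using a by (intro tendsto_powr' tendsto_intros) (auto simp: eventually_at_right[of 0 1] intro!: exI[of _ 1])
    then show "((\<lambda>s. s powr (a / 2)) \<longlongrightarrow> 0) (at_right 0)" by simp
  qed simp
qed (use sigma_pos in auto)

text \<open>For \<open>c \<ge> 1\<close> the bases satisfy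
  \<open>1 - ln s / c \<le> lg s \<le> c * (1 - ln s / c)\<close>.\<close>

lemma sigma_comparable:
  assumes s: "0 < s" "s \<le> 1"
  shows "sigma s \<le> s powr a * lg s powr (1 - a)" "s powr a * lg s powr (1 - a) \<le> c * sigma s"
proof -
  have ln: "ln s \<le> 0" using s by simp
  have "ln s * c \<le> ln s * 1" using c ln by (intro mult_left_mono_neg) auto
  then have "ln s \<le> ln s / c" using c by (simp add: le_divide_eq)
  then have "(1 - ln s / c) powr (1 - a) \<le> lg s powr (1 - a)"
    using a lgpow_base_ge_1[OF c(1) s] unfolding lg_def by (intro powr_mono2) auto
  then show "sigma s \<le> s powr a * lg s powr (1 - a)"
    unfolding sigma_def lgpow_def by (intro mult_left_mono) auto
  have "lg s \<le> c * (1 - ln s / c)" using c by (simp add: lg_def field_simps)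
  then have "lg s powr (1 - a) \<le> (c * (1 - ln s / c)) powr (1 - a)"
    using a lg_ge_1[OF s] by (intro powr_mono2) auto
  also have "\<dots> = c powr (1 - a) * (1 - ln s / c) powr (1 - a)"
    using c lgpow_base_ge_1[OF c(1) s] by (intro powr_mult)
  also have "\<dots> \<le> c powr 1 * (1 - ln s / c) powr (1 - a)"
    using a c by (intro mult_right_mono powr_mono) auto
  finally have "s powr a * lg s powr (1 - a) \<le> s powr a * (c powr 1 * (1 - ln s / c) powr (1 - a))"
    by (intro mult_left_mono) auto
  then show "s powr a * lg s powr (1 - a) \<le> c * sigma s"
    using c by (simp add: sigma_def lgpow_def mult_ac)
qed

end

section \<open>The interpolation theorem\<close>

text \<open>Meant for the K-functional, an infimum over an uncountable family, whose measurability
  in \<open>t\<close> comes from monotonicity: sublevel sets are intervals.\<close>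

lemma borel_measurable_mono_ennreal:
  fixes f :: "real \<Rightarrow> ennreal"
  assumes "mono f"
  shows "f \<in> borel_measurable borel"
proof (rule borel_measurableI_less)
  fix y
  have "is_interval {x. f x < y}"
    unfolding is_interval_1 using monoD[OF assms] by (blast intro: le_less_trans)
  then show "{x \<in> space borel. f x < y} \<in> sets borel"
    using real_interval_borel_measurable by simp
qed

text \<open>The origin of both target exponents: with \<open>a = 1 / p - 1 / q\<close>, the power is
  \<open>1 / p - \<theta> * a\<close> and the logarithm gets
  \<open>1 - 1 / p - \<theta> * (1 - a)\<close>.\<close>

lemma LZ_weight_eq:
  fixes \<theta> p q u :: real
  assumes "0 < u" "u \<le> 1" "1 < p" "p < q" "0 < \<theta>" "\<theta> < 1"
  shows "(u powr (1 / p - 1 / q) * lg u powr (1 - (1 / p - 1 / q))) powr (- \<theta>) * phi_small p u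
    = u powr ((1 - \<theta>) / p + \<theta> / q) * lg u powr (1 - \<theta> - ((1 - \<theta>) / p + \<theta> / q))"
proof -
  have l: "0 < lg u" using lg_ge_1[OF assms(1,2)] by simp
  have "(u powr (1 / p - 1 / q) * lg u powr (1 - (1 / p - 1 / q))) powr (- \<theta>) * phi_small p u
     = (u powr (- \<theta> * (1 / p - 1 / q)) * u powr (1 / p)) *
       (lg u powr (- \<theta> * (1 - (1 / p - 1 / q))) * lg u powr (1 - 1 / p))"
    using assms(1) l by (simp add: phi_small_def powr_mult powr_powr mult_ac)
  also have "\<dots> = u powr (- \<theta> * (1 / p - 1 / q) + 1 / p) * lg u powr (- \<theta> * (1 - (1 / p - 1 / q)) + (1 - 1 / p))"
    using assms(1) l by (simp only: powr_add)
  also have "- \<theta> * (1 / p - 1 / q) + 1 / p = (1 - \<theta>) / p + \<theta> / q"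
    using assms by (simp add: field_simps)
  also have "- \<theta> * (1 - (1 / p - 1 / q)) + (1 - 1 / p) = 1 - \<theta> - ((1 - \<theta>) / p + \<theta> / q)"
    using assms by (simp add: field_simps)
  finally show ?thesis .
qed

context
  fixes \<Omega> :: "'a::euclidean_space set" and p q \<theta> r a c :: real
  assumes \<Omega>: "\<Omega> \<in> sets lebesgue" "emeasure lebesgue \<Omega> < \<infinity>"
    and p: "1 < p" and pq: "p < q" and \<theta>: "0 < \<theta>" "\<theta> < 1" and r: "1 \<le> r"
    and a_eq: "a = 1 / p - 1 / q" and c: "1 \<le> c" "2 * (1 - a) \<le> a * c"
begin

abbreviation (input) "\<sigma> \<equiv> sigma a c"

abbreviation (input) "W g u \<equiv> u powr ((1 - \<theta>) / p + \<theta> / q)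
  * lg u powr (1 - \<theta> - ((1 - \<theta>) / p + \<theta> / q)) * rearr \<Omega> g u"

abbreviation (input) "K \<equiv> K_fun \<Omega> (small_leb_norm \<Omega> p) (grand_leb_norm \<Omega> q)"

lemma a_bounds: "0 < a" "a < 1"
proof -
  have "1 / q < 1 / p" using p pq by (intro divide_strict_left_mono) auto
  then show "0 < a" by (simp add: a_eq)
  have "1 / p < 1" "0 < 1 / q" using p pq by auto
  then show "a < 1" unfolding a_eq by linarith
qed

lemmas sigma_ac_pos = sigma_pos[OF a_bounds c]

lemma phi_quotient:
  assumes "0 < s" "s \<le> 1"
  shows "s powr a * lg s powr (1 - a) * phi_grand q s = phi_small p s"
proof -
  have "0 < lg s" using lg_ge_1[OF assms] by simp
  then have "s powr a * lg s powr (1 - a) * phi_grand q s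
     = s powr (a + 1 / q) * lg s powr (1 - a + - (1 / q))"
    using assms unfolding phi_grand_def powr_add by (simp only: mult_ac)
  then show ?thesis by (simp add: phi_small_def a_eq)
qed

lemma sigma_phi_le:
  assumes "0 < s" "s \<le> 1"
  shows "\<sigma> s * phi_grand q s \<le> phi_small p s"
  using mult_right_mono[OF sigma_comparable(1)[OF a_bounds c assms], of "phi_grand q s"] phi_quotient[OF assms]
  by simp

text \<open>The exponent \<open>- \<theta>\<close> is negative, so the comparison of
  \<open>sigma\<close> with \<rho> is reversed, at a cost of
  \<open>c powr \<theta> \<le> c\<close>.\<close>

lemma W_le:
  assumes u: "0 < u" "u \<le> 1" and g: "g \<in> borel_measurable lebesgue"
  shows "W g u \<le> \<sigma> u powr (- \<theta>) * phi_small p u * rearr \<Omega> g u"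
    and "\<sigma> u powr (- \<theta>) * phi_small p u * rearr \<Omega> g u \<le> c * W g u"
proof -
  have h: "0 \<le> phi_small p u * rearr \<Omega> g u" using rearr_nonneg[OF \<Omega> g u(1)] by simp
  define \<rho> where "\<rho> = u powr a * lg u powr (1 - a)"
  have W: "W g u = \<rho> powr (- \<theta>) * (phi_small p u * rearr \<Omega> g u)"
    using LZ_weight_eq[OF u p pq \<theta>] by (simp add: \<rho>_def a_eq mult.assoc)
  have s: "0 < \<sigma> u" "\<sigma> u \<le> \<rho>" "\<rho> \<le> c * \<sigma> u"
    using sigma_ac_pos[OF u] sigma_comparable[OF a_bounds c u] by (auto simp: \<rho>_def)
  have "\<rho> powr (- \<theta>) \<le> \<sigma> u powr (- \<theta>)" using s \<theta> by (intro powr_mono2') auto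
  then show "W g u \<le> \<sigma> u powr (- \<theta>) * phi_small p u * rearr \<Omega> g u"
    unfolding W using mult_right_mono[OF _ h, of "\<rho> powr (- \<theta>)"] by (simp add: mult.assoc)
  have "(c * \<sigma> u) powr (- \<theta>) \<le> \<rho> powr (- \<theta>)" using s \<theta> by (intro powr_mono2') auto
  then have "\<sigma> u powr (- \<theta>) \<le> c powr \<theta> * \<rho> powr (- \<theta>)"
    using s(1) c(1) by (simp add: powr_mult powr_minus field_simps)
  also have "\<dots> \<le> c powr 1 * \<rho> powr (- \<theta>)"
    using \<theta> c(1) by (intro mult_right_mono powr_mono) auto
  finally have "\<sigma> u powr (- \<theta>) \<le> c * \<rho> powr (- \<theta>)" using c(1) by simp
  from mult_right_mono[OF this h] show "\<sigma> u powr (- \<theta>) * phi_small p u * rearr \<Omega> g u \<le> c * W g u"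
    unfolding W by (simp add: mult.assoc)
qed

lemma measurable_K [measurable]: "K g \<in> borel_measurable borel"
  by (intro borel_measurable_mono_ennreal monoI K_fun_mono)

lemma interp_integral_sigma:
  "(\<integral>\<^sup>+ t. indicator {0<..<1} t * epowr (ennreal (t powr (- \<theta>)) * K g t) r * ennreal (1 / t) \<partial>lborel)
  = (\<integral>\<^sup>+ s. indicator {0<..<1} s * epowr (ennreal (\<sigma> s powr (- \<theta>)) * K g (\<sigma> s)) r
      * ennreal (sigma_deriv a c s / \<sigma> s) \<partial>lborel)"
proof -
  have [measurable]: "\<sigma> \<in> borel_measurable borel" by (rule measurable_sigma[OF a_bounds c])
  define H where "H t = epowr (ennreal (t powr (- \<theta>)) * K g t) r * ennreal (1 / t)" for t
  have [measurable]: "H \<in> borel_measurable borel" unfolding H_def[abs_def] by measurable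
  have "(\<integral>\<^sup>+ t. indicator {0<..<1} t * H t \<partial>lborel)
     = (\<integral>\<^sup>+ s. indicator {0<..<1} s * (H (\<sigma> s) * ennreal (sigma_deriv a c s)) \<partial>lborel)"
    by (rule nn_integral_sigma_substitution[OF a_bounds c]) measurable
  also have "\<dots> = (\<integral>\<^sup>+ s. indicator {0<..<1} s * epowr (ennreal (\<sigma> s powr (- \<theta>)) * K g (\<sigma> s)) r
      * ennreal (sigma_deriv a c s / \<sigma> s) \<partial>lborel)"
  proof (rule nn_integral_cong)
    fix s :: real
    show "indicator {0<..<1} s * (H (\<sigma> s) * ennreal (sigma_deriv a c s)) =
      indicator {0<..<1} s * epowr (ennreal (\<sigma> s powr (- \<theta>)) * K g (\<sigma> s)) r * ennreal (sigma_deriv a c s / \<sigma> s)"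
    proof (cases "s \<in> {0<..<1}")
      case True
      then have "ennreal (sigma_deriv a c s / \<sigma> s) = ennreal (1 / \<sigma> s) * ennreal (sigma_deriv a c s)"
        using sigma_ac_pos[of s] ennreal_mult'[of "1 / \<sigma> s" "sigma_deriv a c s"] by simp
      then show ?thesis by (simp only: H_def mult_ac)
    qed simp
  qed
  finally show ?thesis by (simp only: H_def mult.assoc)
qed

text \<open>Moving \<open>\<sigma> s powr (- \<theta>)\<close> to the point \<open>u\<close> leaves
  a ratio of \<open>sigma\<close> values, with exponent \<open>\<theta>\<close> below
  \<open>s\<close> and \<open>1 - \<theta>\<close> above.\<close>

lemma K_sigma_le:
  "\<exists>C>0. \<forall>g\<in>borel_measurable lebesgue. \<forall>s. 0 < s \<longrightarrow> s < 1 \<longrightarrow>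
    ennreal (\<sigma> s powr (- \<theta>)) * K g (\<sigma> s) \<le> ennreal C *
      (\<integral>\<^sup>+ u. indicator {0<..<1} u * ennreal (hardy_ker (min \<theta> (1 - \<theta>) * (a / 2)) s u / u) * ennreal (W g u) \<partial>lborel)"
proof -
  \<comment> \<open>The weaker of the two decay rates; it is positive because \<theta> lies strictly
    between 0 and 1.\<close>
  define \<delta> where "\<delta> = min \<theta> (1 - \<theta>) * (a / 2)"
  have \<delta>: "\<delta> \<le> \<theta> * (a / 2)" "\<delta> \<le> (1 - \<theta>) * (a / 2)"
    unfolding \<delta>_def using a_bounds by (auto intro!: mult_right_mono)
  have [measurable]: "\<sigma> \<in> borel_measurable borel" by (rule measurable_sigma[OF a_bounds c])
  have q: "1 < q" using p pq by simp
  obtain C where C: "0 < C" and KC: "\<And>g s t. g\<in>borel_measurable lebesgue \<Longrightarrow> 0 < s \<Longrightarrow> s < 1 \<Longrightarrow> 0 \<le> t \<Longrightarrow>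
      t * phi_grand q s \<le> phi_small p s \<Longrightarrow>
      K g t \<le> ennreal C * ((\<integral>\<^sup>+ u. indicator {0<..<s} u * ennreal (phi_small p u * rearr \<Omega> g u / u) \<partial>lborel)
      + ennreal t * (\<integral>\<^sup>+ u. indicator {s..<1} u * ennreal (phi_grand q u * rearr \<Omega> g u / u) \<partial>lborel))"
    using K_fun_le[OF \<Omega> p q] by blast
  have "ennreal (\<sigma> s powr (- \<theta>)) * K g (\<sigma> s) \<le> ennreal (C * c) *
      (\<integral>\<^sup>+ u. indicator {0<..<1} u * ennreal (hardy_ker \<delta> s u / u) * ennreal (W g u) \<partial>lborel)"
    if g: "g \<in> borel_measurable lebesgue" and s: "0 < s" "s < 1" for g s
  proof -
    have [measurable]: "rearr \<Omega> g \<in> borel_measurable borel"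
      by (rule borel_measurable_rearr[OF \<Omega> g])
    have s0: "0 < \<sigma> s" using sigma_ac_pos[of s] s by simp
    have t: "0 \<le> \<sigma> s" "\<sigma> s * phi_grand q s \<le> phi_small p s"
      using s0 sigma_phi_le[of s] s by auto
    define F where "F u = \<sigma> u powr (- \<theta>) * phi_small p u * rearr \<Omega> g u" for u
    have F: "0 \<le> F u" if "0 < u" for u
      using rearr_nonneg[OF \<Omega> g that] by (simp add: F_def)
    have low: "\<sigma> s powr (- \<theta>) * (phi_small p u * rearr \<Omega> g u / u) \<le> hardy_ker \<delta> s u / u * F u"
      if u: "0 < u" "u < s" for u
    proof -
      have u0: "0 < \<sigma> u" using sigma_ac_pos[of u] u s by simp
      have "\<sigma> s powr (- \<theta>) = (\<sigma> u / \<sigma> s) powr \<theta> * \<sigma> u powr (- \<theta>)"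
        using u0 s0 by (simp add: powr_divide powr_minus field_simps)
      also have "\<dots> \<le> hardy_ker \<delta> s u * \<sigma> u powr (- \<theta>)"
        using sigma_ratio_powr_le[OF a_bounds c u(1), of s \<theta> \<delta>] u s \<theta> \<delta>
        by (intro mult_right_mono) (auto simp: hardy_ker_def)
      finally have "\<sigma> s powr (- \<theta>) * (phi_small p u * rearr \<Omega> g u / u)
          \<le> hardy_ker \<delta> s u * \<sigma> u powr (- \<theta>) * (phi_small p u * rearr \<Omega> g u / u)"
        using rearr_nonneg[OF \<Omega> g u(1)] u by (intro mult_right_mono) auto
      then show ?thesis by (simp add: F_def mult_ac)
    qed
    \<comment> \<open>The extra factor \<open>\<sigma> s\<close> changes the exponent from
      \<open>- \<theta>\<close> to \<open>1 - \<theta>\<close>. The factor \<open>\<sigma> u\<close>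
      left over turns \<open>phi_grand q u\<close> into at most
      \<open>phi_small p u\<close>.\<close>
    have high: "\<sigma> s powr (- \<theta>) * \<sigma> s * (phi_grand q u * rearr \<Omega> g u / u) \<le> hardy_ker \<delta> s u / u * F u"
      if u: "s \<le> u" "u < 1" for u
    proof -
      have u0: "0 < \<sigma> u" using sigma_ac_pos[of u] u s by simp
      have "\<sigma> s powr (- \<theta>) * \<sigma> s = (\<sigma> s / \<sigma> u) powr (1 - \<theta>) * \<sigma> u powr (- \<theta>) * \<sigma> u"
        using u0 s0 by (simp add: powr_divide powr_minus powr_diff field_simps)
      also have "\<dots> \<le> hardy_ker \<delta> s u * \<sigma> u powr (- \<theta>) * \<sigma> u"
        using sigma_ratio_powr_le[OF a_bounds c s(1), of u "1 - \<theta>" \<delta>] u s \<theta> \<delta> u0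
        by (intro mult_right_mono) (auto simp: hardy_ker_def)
      finally have "\<sigma> s powr (- \<theta>) * \<sigma> s * (phi_grand q u * rearr \<Omega> g u / u)
          \<le> hardy_ker \<delta> s u * \<sigma> u powr (- \<theta>) * \<sigma> u * (phi_grand q u * rearr \<Omega> g u / u)"
        using rearr_nonneg[OF \<Omega> g, of u] u s by (intro mult_right_mono) auto
      also have "\<dots> = hardy_ker \<delta> s u * \<sigma> u powr (- \<theta>) * ((\<sigma> u * phi_grand q u) * (rearr \<Omega> g u / u))"
        by simp
      also have "\<dots> \<le> hardy_ker \<delta> s u * \<sigma> u powr (- \<theta>) * (phi_small p u * (rearr \<Omega> g u / u))"
        using rearr_nonneg[OF \<Omega> g, of u] u s sigma_phi_le[of u]
        by (intro mult_left_mono mult_right_mono) auto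
      finally show ?thesis by (simp add: F_def mult_ac)
    qed
    have "ennreal (\<sigma> s powr (- \<theta>)) * K g (\<sigma> s)
      \<le> ennreal (\<sigma> s powr (- \<theta>)) * (ennreal C * ((\<integral>\<^sup>+ u. indicator {0<..<s} u * ennreal (phi_small p u * rearr \<Omega> g u / u) \<partial>lborel)
      + ennreal (\<sigma> s) * (\<integral>\<^sup>+ u. indicator {s..<1} u * ennreal (phi_grand q u * rearr \<Omega> g u / u) \<partial>lborel)))"
      by (intro mult_left_mono KC g s t) auto
    also have "\<dots> = ennreal C * (ennreal (\<sigma> s powr (- \<theta>)) *
        (\<integral>\<^sup>+ u. indicator {0<..<s} u * ennreal (phi_small p u * rearr \<Omega> g u / u) \<partial>lborel)
        + ennreal (\<sigma> s powr (- \<theta>) * \<sigma> s) *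
        (\<integral>\<^sup>+ u. indicator {s..<1} u * ennreal (phi_grand q u * rearr \<Omega> g u / u) \<partial>lborel))"
      using s0 by (simp add: ennreal_mult distrib_left mult_ac)
    also have "\<dots> = ennreal C * (\<integral>\<^sup>+ u.
        ennreal (\<sigma> s powr (- \<theta>)) * (indicator {0<..<s} u * ennreal (phi_small p u * rearr \<Omega> g u / u))
        + ennreal (\<sigma> s powr (- \<theta>) * \<sigma> s) * (indicator {s..<1} u * ennreal (phi_grand q u * rearr \<Omega> g u / u)) \<partial>lborel)"
      using s0 by (subst nn_integral_add) (auto simp: nn_integral_cmult)
    also have "\<dots> \<le> ennreal C * (\<integral>\<^sup>+ u. ennreal c *
        (indicator {0<..<1} u * ennreal (hardy_ker \<delta> s u / u) * ennreal (W g u)) \<partial>lborel)"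
    proof (intro mult_left_mono nn_integral_mono)
      fix u :: real
      have FW: "ennreal (hardy_ker \<delta> s u / u * F u) \<le> ennreal c * (ennreal (hardy_ker \<delta> s u / u) * ennreal (W g u))"
        if u: "0 < u" "u < 1"
      proof -
        have "F u \<le> c * W g u" using W_le(2)[OF _ _ g, of u] u by (simp add: F_def)
        then have "hardy_ker \<delta> s u / u * F u \<le> hardy_ker \<delta> s u / u * (c * W g u)"
          using u by (intro mult_left_mono) auto
        then have "ennreal (hardy_ker \<delta> s u / u * F u) \<le> ennreal (c * (hardy_ker \<delta> s u / u * W g u))"
          by (intro ennreal_leI) (simp only: mult_ac)
        also have "\<dots> = ennreal c * (ennreal (hardy_ker \<delta> s u / u) * ennreal (W g u))"
          using u rearr_nonneg[OF \<Omega> g, of u] c(1) by (subst ennreal_mult, simp, simp, subst ennreal_mult) auto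
        finally show ?thesis .
      qed
      consider "u \<le> 0 \<or> 1 \<le> u" | "0 < u" "u < s" | "s \<le> u" "u < 1" by linarith
      then show "ennreal (\<sigma> s powr (- \<theta>)) * (indicator {0<..<s} u * ennreal (phi_small p u * rearr \<Omega> g u / u))
        + ennreal (\<sigma> s powr (- \<theta>) * \<sigma> s) * (indicator {s..<1} u * ennreal (phi_grand q u * rearr \<Omega> g u / u))
        \<le> ennreal c * (indicator {0<..<1} u * ennreal (hardy_ker \<delta> s u / u) * ennreal (W g u))"
      proof cases
        case 1
        then show ?thesis using s by auto
      next
        case 2
        then have "ennreal (\<sigma> s powr (- \<theta>)) * ennreal (phi_small p u * rearr \<Omega> g u / u)
            \<le> ennreal (hardy_ker \<delta> s u / u * F u)"
          using rearr_nonneg[OF \<Omega> g, of u] low[of u]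
          by (subst ennreal_mult[symmetric]) (auto intro!: ennreal_leI)
        also note FW
        finally show ?thesis using 2 s by simp
      next
        case 3
        then have "ennreal (\<sigma> s powr (- \<theta>) * \<sigma> s) * ennreal (phi_grand q u * rearr \<Omega> g u / u)
            \<le> ennreal (hardy_ker \<delta> s u / u * F u)"
          using rearr_nonneg[OF \<Omega> g, of u] high[of u] s s0
          by (subst ennreal_mult[symmetric]) (auto intro!: ennreal_leI)
        also note FW
        finally show ?thesis using 3 s by simp
      qed
    qed simp
    also have "\<dots> = ennreal (C * c) *
        (\<integral>\<^sup>+ u. indicator {0<..<1} u * ennreal (hardy_ker \<delta> s u / u) * ennreal (W g u) \<partial>lborel)"
      using C c(1) by (subst nn_integral_cmult) (auto simp: ennreal_mult mult.assoc)
    finally show ?thesis .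
  qed
  then show ?thesis using C c(1) unfolding \<delta>_def by (intro exI[of _ "C * c"]) auto
qed

lemma interp_integral_le:
  "\<exists>C>0. \<forall>g\<in>borel_measurable lebesgue.
    (\<integral>\<^sup>+ t. indicator {0<..<1} t * epowr (ennreal (t powr (- \<theta>)) * K g t) r * ennreal (1 / t) \<partial>lborel)
    \<le> ennreal C * (\<integral>\<^sup>+ u. indicator {0<..<1} u * ennreal (W g u powr r / u) \<partial>lborel)"
proof -
  define \<delta> where "\<delta> = min \<theta> (1 - \<theta>) * (a / 2)"
  have \<delta>: "0 < \<delta>" unfolding \<delta>_def using a_bounds \<theta> by (intro mult_pos_pos) auto
  obtain C where C: "0 < C" and KC: "\<And>g s. g\<in>borel_measurable lebesgue \<Longrightarrow> 0 < s \<Longrightarrow> s < 1 \<Longrightarrow>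
    ennreal (\<sigma> s powr (- \<theta>)) * K g (\<sigma> s) \<le> ennreal C *
      (\<integral>\<^sup>+ u. indicator {0<..<1} u * ennreal (hardy_ker \<delta> s u / u) * ennreal (W g u) \<partial>lborel)"
    using K_sigma_le unfolding \<delta>_def[symmetric] by blast
  \<comment> \<open>\<open>a\<close> bounds the density of \<open>dt / t\<close> against
    \<open>ds / s\<close>, and \<open>C powr r\<close> is the constant of \<open>K_sigma_le\<close>
    after raising to the power \<open>r\<close>.\<close>
  define D where "D = a * C powr r"
  have "(\<integral>\<^sup>+ t. indicator {0<..<1} t * epowr (ennreal (t powr (- \<theta>)) * K g t) r * ennreal (1 / t) \<partial>lborel)
    \<le> ennreal (D * (2 / \<delta>) powr r) * (\<integral>\<^sup>+ u. indicator {0<..<1} u * ennreal (W g u powr r / u) \<partial>lborel)"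
    if g: "g\<in>borel_measurable lebesgue" for g
  proof -
    have [measurable]: "rearr \<Omega> g \<in> borel_measurable borel"
      by (rule borel_measurable_rearr[OF \<Omega> g])
    define J where "J s = (\<integral>\<^sup>+ u. indicator {0<..<1} u * ennreal (hardy_ker \<delta> s u / u) * ennreal (W g u) \<partial>lborel)" for s
    have [measurable]: "J \<in> borel_measurable borel" unfolding J_def[abs_def] by measurable
    have "(\<integral>\<^sup>+ s. indicator {0<..<1} s * epowr (ennreal (\<sigma> s powr (- \<theta>)) * K g (\<sigma> s)) r
      * ennreal (sigma_deriv a c s / \<sigma> s) \<partial>lborel)
      \<le> (\<integral>\<^sup>+ s. ennreal D * (indicator {0<..<1} s * epowr (J s) r * ennreal (1 / s)) \<partial>lborel)"
    proof (rule nn_integral_mono)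
      fix s :: real
      show "indicator {0<..<1} s * epowr (ennreal (\<sigma> s powr (- \<theta>)) * K g (\<sigma> s)) r
        * ennreal (sigma_deriv a c s / \<sigma> s) \<le> ennreal D * (indicator {0<..<1} s * epowr (J s) r * ennreal (1 / s))"
      proof (cases "s \<in> {0<..<1}")
        case True
        have "epowr (ennreal (\<sigma> s powr (- \<theta>)) * K g (\<sigma> s)) r \<le> epowr (ennreal C * J s) r"
          using KC[OF g, of s] True r by (intro epowr_mono) (auto simp: J_def)
        also have "\<dots> = ennreal (C powr r) * epowr (J s) r"
          using C by (rule epowr_cmult)
        finally have 1: "epowr (ennreal (\<sigma> s powr (- \<theta>)) * K g (\<sigma> s)) r \<le> ennreal (C powr r) * epowr (J s) r" .
        have "ennreal (sigma_deriv a c s / \<sigma> s) \<le> ennreal (a * (1 / s))"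
          using True by (intro ennreal_leI sigma_deriv_bounds(2)[OF a_bounds c]) auto
        also have "\<dots> = ennreal a * ennreal (1 / s)"
          using a_bounds True by (intro ennreal_mult) auto
        finally have "epowr (ennreal (\<sigma> s powr (- \<theta>)) * K g (\<sigma> s)) r * ennreal (sigma_deriv a c s / \<sigma> s)
            \<le> (ennreal (C powr r) * epowr (J s) r) * (ennreal a * ennreal (1 / s))"
          using 1 by (intro mult_mono) auto
        also have "\<dots> = ennreal D * (epowr (J s) r * ennreal (1 / s))"
        proof -
          have "ennreal D = ennreal a * ennreal (C powr r)"
            unfolding D_def using a_bounds by (intro ennreal_mult) auto
          then show ?thesis by (simp only: mult_ac)
        qed
        finally show ?thesis using True by simp
      qed simp
    qed
    also have "\<dots> = ennreal D * (\<integral>\<^sup>+ s. indicator {0<..<1} s * epowr (J s) r * ennreal (1 / s) \<partial>lborel)"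
      by (rule nn_integral_cmult) measurable
    also have "\<dots> \<le> ennreal D * (ennreal ((2 / \<delta>) powr r) *
        (\<integral>\<^sup>+ u. indicator {0<..<1} u * epowr (ennreal (W g u)) r * ennreal (1 / u) \<partial>lborel))"
      unfolding J_def by (intro mult_left_mono nn_integral_hardy_ker_powr_le \<delta> r) auto
    also have "(\<integral>\<^sup>+ u. indicator {0<..<1} u * epowr (ennreal (W g u)) r * ennreal (1 / u) \<partial>lborel)
        = (\<integral>\<^sup>+ u. indicator {0<..<1} u * ennreal (W g u powr r / u) \<partial>lborel)"
    proof (rule nn_integral_cong)
      fix u :: real
      show "indicator {0<..<1} u * epowr (ennreal (W g u)) r * ennreal (1 / u)
        = indicator {0<..<1} u * ennreal (W g u powr r / u)"
      proof (cases "u \<in> {0<..<1}")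
        case True
        then have "0 \<le> W g u" using rearr_nonneg[OF \<Omega> g, of u] by simp
        then show ?thesis using True by (simp add: epowr_ennreal ennreal_mult[symmetric])
      qed simp
    qed
    finally show ?thesis
      unfolding interp_integral_sigma using a_bounds by (simp add: D_def ennreal_mult mult.assoc)
  qed
  then show ?thesis using a_bounds C \<delta> by (intro exI[of _ "D * (2 / \<delta>) powr r"]) (auto simp: D_def)
qed

text \<open>This direction holds pointwise in \<open>s\<close>, before integration; only the density
  of the change of variables enters, through its lower bound \<open>a / 2\<close>.\<close>

lemma LZ_integral_le:
  "\<exists>C>0. \<forall>g\<in>borel_measurable lebesgue.
    (\<integral>\<^sup>+ u. indicator {0<..<1} u * ennreal (W g u powr r / u) \<partial>lborel) \<le> ennreal C *
    (\<integral>\<^sup>+ t. indicator {0<..<1} t * epowr (ennreal (t powr (- \<theta>)) * K g t) r * ennreal (1 / t) \<partial>lborel)"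
proof -
  have q: "1 < q" using p pq by simp
  have [measurable]: "\<sigma> \<in> borel_measurable borel" "sigma_deriv a c \<in> borel_measurable borel"
    by (rule measurable_sigma[OF a_bounds c] measurable_sigma_deriv[OF a_bounds c])+
  obtain C where C: "0 < C" and KC: "\<And>g s t. g\<in>borel_measurable lebesgue \<Longrightarrow> 0 < s \<Longrightarrow> s \<le> 1 \<Longrightarrow>
      t * phi_grand q s = phi_small p s \<Longrightarrow> ennreal (phi_small p s * rearr \<Omega> g s) \<le> ennreal C * K g t"
    using K_fun_ge[OF \<Omega> p q] by blast
  define D where "D = C * c"
  have D: "0 < D" using C c(1) by (simp add: D_def)
  define E where "E = D powr r * (2 / a)"
  have E: "0 < E" using D a_bounds by (simp add: E_def)
  have "(\<integral>\<^sup>+ u. indicator {0<..<1} u * ennreal (W g u powr r / u) \<partial>lborel) \<le> ennreal E *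
    (\<integral>\<^sup>+ t. indicator {0<..<1} t * epowr (ennreal (t powr (- \<theta>)) * K g t) r * ennreal (1 / t) \<partial>lborel)"
    if g: "g\<in>borel_measurable lebesgue" for g
  proof -
    have "(\<integral>\<^sup>+ u. indicator {0<..<1} u * ennreal (W g u powr r / u) \<partial>lborel)
      \<le> (\<integral>\<^sup>+ s. ennreal E * (indicator {0<..<1} s * epowr (ennreal (\<sigma> s powr (- \<theta>)) * K g (\<sigma> s)) r
      * ennreal (sigma_deriv a c s / \<sigma> s)) \<partial>lborel)"
    proof (rule nn_integral_mono)
      fix s :: real
      show "indicator {0<..<1} s * ennreal (W g s powr r / s)
        \<le> ennreal E * (indicator {0<..<1} s * epowr (ennreal (\<sigma> s powr (- \<theta>)) * K g (\<sigma> s)) r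
          * ennreal (sigma_deriv a c s / \<sigma> s))"
      proof (cases "s \<in> {0<..<1}")
        case True
        then have s: "0 < s" "s \<le> 1" by auto
        have h: "0 \<le> rearr \<Omega> g s" using rearr_nonneg[OF \<Omega> g s(1)] .
        have "ennreal (phi_small p s * rearr \<Omega> g s)
            \<le> ennreal C * K g (s powr a * lg s powr (1 - a))"
          by (intro KC g s phi_quotient)
        \<comment> \<open>\<open>K_fun_ge\<close> speaks of the exact quotient \<rho>(s);
          monotonicity and scaling of the K-functional move the argument to
          \<open>\<sigma> s\<close> at the cost of \<open>c\<close>.\<close>
        also have "\<dots> \<le> ennreal C * K g (c * \<sigma> s)"
          by (intro mult_left_mono K_fun_mono sigma_comparable(2)[OF a_bounds c s]) auto
        also have "\<dots> \<le> ennreal C * (ennreal c * K g (\<sigma> s))"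
          by (intro mult_left_mono K_fun_scale c(1) less_imp_le[OF sigma_ac_pos] s) auto
        also have "\<dots> = ennreal D * K g (\<sigma> s)"
          unfolding D_def using C c(1) by (simp add: ennreal_mult mult.assoc)
        finally have K: "ennreal (phi_small p s * rearr \<Omega> g s) \<le> ennreal D * K g (\<sigma> s)" .
        have "ennreal (W g s) \<le> ennreal (\<sigma> s powr (- \<theta>) * (phi_small p s * rearr \<Omega> g s))"
          using W_le(1)[OF s g] by (intro ennreal_leI) (simp only: mult.assoc)
        also have "\<dots> = ennreal (\<sigma> s powr (- \<theta>)) * ennreal (phi_small p s * rearr \<Omega> g s)"
          using h by (intro ennreal_mult) auto
        also have "\<dots> \<le> ennreal (\<sigma> s powr (- \<theta>)) * (ennreal D * K g (\<sigma> s))"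
          by (intro mult_left_mono K) auto
        also have "\<dots> = ennreal D * (ennreal (\<sigma> s powr (- \<theta>)) * K g (\<sigma> s))"
          by (simp only: mult_ac)
        finally have "epowr (ennreal (W g s)) r \<le> epowr (ennreal D * (ennreal (\<sigma> s powr (- \<theta>)) * K g (\<sigma> s))) r"
          using r by (intro epowr_mono) auto
        then have 1: "ennreal (W g s powr r) \<le> ennreal (D powr r) * epowr (ennreal (\<sigma> s powr (- \<theta>)) * K g (\<sigma> s)) r"
          using D h by (simp add: epowr_cmult epowr_ennreal)
        have "1 / s \<le> 2 / a * (sigma_deriv a c s / \<sigma> s)"
          using mult_left_mono[OF sigma_deriv_bounds(1)[OF a_bounds c s], of "2 / a"] a_bounds by simp
        then have "ennreal (1 / s) \<le> ennreal (2 / a * (sigma_deriv a c s / \<sigma> s))"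
          by (rule ennreal_leI)
        also have "\<dots> = ennreal (2 / a) * ennreal (sigma_deriv a c s / \<sigma> s)"
          using a_bounds by (intro ennreal_mult') auto
        finally have 2: "ennreal (1 / s) \<le> ennreal (2 / a) * ennreal (sigma_deriv a c s / \<sigma> s)" .
        have "ennreal (W g s powr r / s) = ennreal (W g s powr r) * ennreal (1 / s)"
          using s by (simp add: ennreal_mult[symmetric])
        also have "\<dots> \<le> (ennreal (D powr r) * epowr (ennreal (\<sigma> s powr (- \<theta>)) * K g (\<sigma> s)) r)
            * (ennreal (2 / a) * ennreal (sigma_deriv a c s / \<sigma> s))"
          by (intro mult_mono 1 2) auto
        also have "\<dots> = ennreal E * (epowr (ennreal (\<sigma> s powr (- \<theta>)) * K g (\<sigma> s)) r
            * ennreal (sigma_deriv a c s / \<sigma> s))"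
        proof -
          have "ennreal E = ennreal (D powr r) * ennreal (2 / a)"
            unfolding E_def using a_bounds by (intro ennreal_mult) auto
          then show ?thesis by (simp only: mult_ac)
        qed
        finally show ?thesis using True by simp
      qed simp
    qed
    also have "\<dots> = ennreal E * (\<integral>\<^sup>+ s. indicator {0<..<1} s * epowr (ennreal (\<sigma> s powr (- \<theta>)) * K g (\<sigma> s)) r
      * ennreal (sigma_deriv a c s / \<sigma> s) \<partial>lborel)"
      by (rule nn_integral_cmult) measurable
    finally show ?thesis unfolding interp_integral_sigma .
  qed
  then show ?thesis using E by blast
qed

end

lemma epowr_root_mono:
  assumes "x \<le> ennreal C * y" "0 < C" "1 \<le> r"
  shows "epowr x (1 / r) \<le> ennreal (C powr (1 / r)) * epowr y (1 / r)"
  using epowr_mono[OF _ assms(1), of "1 / r"] assms by (simp add: epowr_cmult)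

theorem theorem5p1:
  fixes \<Omega> :: "'a::euclidean_space set"
    and \<theta> r p q :: real
  assumes "open \<Omega>" and "bounded \<Omega>" and "emeasure lebesgue \<Omega> = 1"
    and "0 < \<theta>" and "\<theta> < 1" and "1 \<le> r" and "1 < p" and "p < q"
  shows "\<exists>C>0. \<forall>g \<in> borel_measurable lebesgue.
    let p\<theta> = 1 / ((1 - \<theta>) / p + \<theta> / q);
        \<alpha>\<theta> = 1 - \<theta> - 1 / p\<theta>
    in interp_norm \<Omega> (small_leb_norm \<Omega> p) (grand_leb_norm \<Omega> q) \<theta> r g
         \<le> ennreal C * LZ_norm \<Omega> p\<theta> r \<alpha>\<theta> g
     \<and> LZ_norm \<Omega> p\<theta> r \<alpha>\<theta> g
         \<le> ennreal C * interp_norm \<Omega> (small_leb_norm \<Omega> p) (grand_leb_norm \<Omega> q) \<theta> r g"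
proof -
  have \<Omega>: "\<Omega> \<in> sets lebesgue" "emeasure lebesgue \<Omega> < \<infinity>"
    using assms(1,3) by (auto simp: borel_open)
  define a where "a = 1 / p - 1 / q"
  \<comment> \<open>The second entry is the least \<open>c\<close> with
    \<open>2 * (1 - a) \<le> a * c\<close>; the maximum adds \<open>1 \<le> c\<close>.\<close>
  define c where "c = max 1 (2 * (1 - a) / a)"
  have "1 / q < 1 / p" using assms(7,8) by (intro divide_strict_left_mono) auto
  then have "0 < a" by (simp add: a_def)
  then have "2 * (1 - a) = a * (2 * (1 - a) / a)" by simp
  also have "\<dots> \<le> a * c" using \<open>0 < a\<close> by (intro mult_left_mono) (auto simp: c_def)
  finally have c: "1 \<le> c" "2 * (1 - a) \<le> a * c" by (auto simp: c_def)
  define e where "e = (1 - \<theta>) / p + \<theta> / q"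
  let ?I = "interp_norm \<Omega> (small_leb_norm \<Omega> p) (grand_leb_norm \<Omega> q) \<theta> r"
  let ?L = "LZ_norm \<Omega> (1 / e) r (1 - \<theta> - e)"
  obtain C1 where C1: "0 < C1" and 1: "\<And>g. g \<in> borel_measurable lebesgue \<Longrightarrow>
      ?I g \<le> ennreal (C1 powr (1 / r)) * ?L g"
    using interp_integral_le[OF \<Omega> assms(7,8,4,5,6) a_def c] epowr_root_mono[OF _ _ assms(6)]
    unfolding interp_norm_def LZ_norm_def e_def lg_def by (simp add: mult.assoc) blast
  obtain C2 where C2: "0 < C2" and 2: "\<And>g. g \<in> borel_measurable lebesgue \<Longrightarrow>
      ?L g \<le> ennreal (C2 powr (1 / r)) * ?I g"
    using LZ_integral_le[OF \<Omega> assms(7,8,4,5,6) a_def c] epowr_root_mono[OF _ _ assms(6)]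
    unfolding interp_norm_def LZ_norm_def e_def lg_def by (simp add: mult.assoc) blast
  define C where "C = max (C1 powr (1 / r)) (C2 powr (1 / r))"
  have "0 < C" using C1 by (simp add: C_def less_max_iff_disj)
  moreover have "?I g \<le> ennreal C * ?L g \<and> ?L g \<le> ennreal C * ?I g"
    if g: "g \<in> borel_measurable lebesgue" for g
  proof
    show "?I g \<le> ennreal C * ?L g"
      by (rule order_trans[OF 1[OF g]]) (auto simp: C_def intro!: mult_right_mono ennreal_leI)
    show "?L g \<le> ennreal C * ?I g"
      by (rule order_trans[OF 2[OF g]]) (auto simp: C_def intro!: mult_right_mono ennreal_leI)
  qed
  ultimately show ?thesis unfolding Let_def e_def by (intro exI[of _ C]) auto
qed

end
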